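(* Let $K\subset\mathbb{R}^4$ be an origin-symmetric convex body of revolution (around the $x_4$ axis) such that its radial function $\rho_K(t)$, written as a function of $t\in[0,1]$, the cosine of the angle with the axis of revolution, is of class $C^2$ in a neighborhood of the axis of revolution (that is, of $t=1$) and satisfies $\rho_K(1)+\rho_K'(1)=0$. Then the intersection body $IK$ of $K$ is not a polar zonoid.
   Context: Let $n=4$. A convex body in $\mathbb{R}^n$ is a compact convex set with nonempty interior. The radial function of an origin-symmetric convex body $K$ is $\rho_K(\xi)=\max\{\lambda\ge 0:\lambda\xi\in K\}$, $\xi\in S^{n-1}$. If $K$ is an origin-symmetric convex body of revolution around the $x_n$ axis (i.e. invariant under all rotations fixing that axis), then $\rho_K(\sqrt{1-t^2}\,\xi,t)$ is independent of $\xi\in S^{n-2}$, and one writes $\rho_K(t)=\rho_K(\sqrt{1-t^2}\,\xi,t)$ for $0\le t\le 1$; thus $t$ is the cosine of the angle with the axis of revolution, $t=1$ corresponds to the axis of revolution and $t=0$ to the equator. Primes denote derivatives with respect to $t$; since $t$ ranges over $[0,1]$, neighborhoods of $t=1$ are taken in $[0,1]$ and derivatives at $t=1$ are one-sided. The intersection body $IK$ of $K$ is the origin-symmetric star body with radial function $\rho_{IK}(\xi)=\mathrm{Vol}_{n-1}(K\cap\xi^\perp)$, $\xi\in S^{n-1}$ (it is convex, by Busemann's theorem). The support function of a compact convex set $Z$ is $h_Z(x)=\sup\{\langle x,u\rangle:u\in Z\}$. A compact convex set $Z\subset\mathbb{R}^n$ is a zonoid (centered at the origin) if there is a finite non-negative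 even Borel measure $\mu$ on $S^{n-1}$ with $h_Z(u)=\int_{S^{n-1}}|\langle u,v\rangle|\,d\mu(v)$ for all $u\in S^{n-1}$. A convex body is a polar zonoid if it is the polar body of such a zonoid; equivalently (since $h_{L^*}=1/\rho_L$), an origin-symmetric convex body $L$ is a polar zonoid if its polar body $L^*=\{x:\langle x,y\rangle\le 1\ \forall y\in L\}$ is a zonoid. *)

theory Defs
  imports "HOL-Analysis.Analysis"
begin

definition convex_body :: "'a::euclidean_space set \<Rightarrow> bool" where
  "convex_body K \<longleftrightarrow> compact K \<and> convex K \<and> interior K \<noteq> {}"

definition origin_symmetric :: "'a::real_vector set \<Rightarrow> bool" where
  "origin_symmetric K \<longleftrightarrow> uminus ` K = K"

definition radial_function :: "'a::real_vector set \<Rightarrow> 'a \<Rightarrow> real" where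
  "radial_function K \<xi> = Sup {r. 0 \<le> r \<and> r *\<^sub>R \<xi> \<in> K}"

definition star_body_of :: "('a::real_normed_vector \<Rightarrow> real) \<Rightarrow> 'a set" where
  "star_body_of \<rho> = {r *\<^sub>R \<xi> | r \<xi>. norm \<xi> = 1 \<and> 0 \<le> r \<and> r \<le> \<rho> \<xi>}"

definition support_function :: "'a::real_inner set \<Rightarrow> 'a \<Rightarrow> real" where
  "support_function Z x = (SUP u\<in>Z. x \<bullet> u)"

definition polar_body :: "'a::real_inner set \<Rightarrow> 'a set" where
  "polar_body L = {x. \<forall>y\<in>L. x \<bullet> y \<le> 1}"

lemma radial_function_star_body_of:
  fixes \<rho> :: "'a::real_normed_vector \<Rightarrow> real"
  assumes "norm \<xi> = 1" "0 \<le> \<rho> \<xi>"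
  shows "radial_function (star_body_of \<rho>) \<xi> = \<rho> \<xi>"
proof -
  have "{r. 0 \<le> r \<and> r *\<^sub>R \<xi> \<in> star_body_of \<rho>} = {0..\<rho> \<xi>}" (is "?A = _")
  proof (intro equalityI subsetI)
    fix r assume "r \<in> ?A"
    then obtain s \<eta> where r: "0 \<le> r" and s: "norm \<eta> = 1" "0 \<le> s" "s \<le> \<rho> \<eta>"
      and eq: "r *\<^sub>R \<xi> = s *\<^sub>R \<eta>"
      unfolding star_body_of_def by auto
    from eq have "norm (r *\<^sub>R \<xi>) = norm (s *\<^sub>R \<eta>)" by simp
    with assms r s have "r = s" by simp
    with eq r s assms show "r \<in> {0..\<rho> \<xi>}" by (cases "r = 0") auto
  next
    fix r assume "r \<in> {0..\<rho> \<xi>}"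
    with assms show "r \<in> ?A" unfolding star_body_of_def by auto
  qed
  with assms show ?thesis unfolding radial_function_def by simp
qed

definition body_of_revolution :: "(real^4) set \<Rightarrow> bool" where
  "body_of_revolution K \<longleftrightarrow>
     (\<forall>Q :: real^4^4. rotation_matrix Q \<and> Q *v axis 4 1 = axis 4 1 \<longrightarrow> (\<lambda>x. Q *v x) ` K = K)"

text \<open>The meridian direction \<^term>\<open>axis 1 1\<close> is an arbitrary choice;
  see \<open>revolution_radial_eq\<close> below.\<close>

definition revolution_radial :: "(real^4) set \<Rightarrow> real \<Rightarrow> real" where
  "revolution_radial K t =
     radial_function K (sqrt (1 - t\<^sup>2) *\<^sub>R axis 1 1 + t *\<^sub>R axis 4 1)"

definition reflection :: "'a::real_inner \<Rightarrow> 'a \<Rightarrow> 'a" where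
  "reflection a x = x - (2 * (a \<bullet> x) / (a \<bullet> a)) *\<^sub>R a"

lemma reflection_orthogonal: "orthogonal_transformation (reflection a)"
proof -
  have "linear (reflection a)"
  proof (rule linearI)
    fix x y :: 'a and c :: real
    show "reflection a (x + y) = reflection a x + reflection a y"
      by (simp add: reflection_def inner_add_right distrib_left add_divide_distrib scaleR_add_left)
    show "reflection a (c *\<^sub>R x) = c *\<^sub>R reflection a x"
      by (simp add: reflection_def scaleR_diff_right mult.left_commute)
  qed
  moreover have "reflection a x \<bullet> reflection a y = x \<bullet> y" for x y
    by (cases "a = 0")
       (auto simp: reflection_def inner_diff_left inner_diff_right inner_commute field_simps)
  ultimately show ?thesis unfolding orthogonal_transformation_def by blast
qed

lemma reflection_swap:
  assumes "norm x = norm y"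
  shows "reflection (x - y) x = y"
proof (cases "x = y")
  case False
  have "2 * ((x - y) \<bullet> x) = (x - y) \<bullet> (x - y)"
    using assms by (simp add: norm_eq inner_diff_left inner_diff_right inner_commute)
  with False show ?thesis by (simp add: reflection_def)
qed (simp add: reflection_def)

lemma det_reflection_eq:
  fixes a b :: "real^'n"
  assumes "norm a = norm b"
  shows "det (matrix (reflection a)) = det (matrix (reflection b))"
proof -
  obtain f where f: "orthogonal_transformation f" "f a = b"
    using orthogonal_transformation_exists[OF assms] by blast
  have lin: "linear f" using f orthogonal_transformation_linear by blast
  have "f (reflection a x) = reflection b (f x)" for x
    using f lin unfolding reflection_def orthogonal_transformation_def
    by (metis linear_diff linear_scale)
  then have "f \<circ> reflection a = reflection b \<circ> f" by auto
  then have "matrix f ** matrix (reflection a) = matrix (reflection b) ** matrix f"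
    using matrix_compose[of "reflection a" f] matrix_compose[of f "reflection b"] lin
      reflection_orthogonal orthogonal_transformation_linear by metis
  then have "det (matrix f) * det (matrix (reflection a)) =
      det (matrix (reflection b)) * det (matrix f)"
    by (metis det_mul)
  moreover have "det (matrix f) \<noteq> 0"
    using f by (metis det_orthogonal_matrix one_neq_zero orthogonal_transformation_matrix
        zero_neq_neg_one)
  ultimately show ?thesis by simp
qed

lemma rotation_fixing_axis_exists:
  fixes \<xi> \<eta> e :: "real^4"
  assumes "norm \<xi> = norm \<eta>" "\<xi> \<bullet> e = 0" "\<eta> \<bullet> e = 0"
  obtains Q :: "real^4^4" where "rotation_matrix Q" "Q *v e = e" "Q *v \<xi> = \<eta>"
proof (cases "\<xi> = \<eta>")
  case True
  show ?thesis
    by (rule that[of "mat 1"]) (auto simp: rotation_matrix_def orthogonal_matrix_id True)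
next
  case False
  have "dim {\<xi>, \<eta>, e} < DIM(real^4)"
    using dim_le_card'[of "{\<xi>, \<eta>, e}"] card_length[of "[\<xi>, \<eta>, e]"] by simp
  then obtain b where b: "b \<noteq> 0" "\<And>y. y \<in> span {\<xi>, \<eta>, e} \<Longrightarrow> orthogonal b y"
    using orthogonal_to_subspace_exists by blast
  define c where "c = (norm (\<xi> - \<eta>) / norm b) *\<^sub>R b"
  have nc: "norm (\<xi> - \<eta>) = norm c" using b by (simp add: c_def)
  have "b \<bullet> \<xi> = 0" "b \<bullet> e = 0"
    using b(2)[unfolded orthogonal_def] by (simp_all add: span_base)
  then have c: "c \<bullet> \<xi> = 0" "c \<bullet> e = 0" by (simp_all add: c_def)
  define g where "g = reflection (\<xi> - \<eta>) \<circ> reflection c"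
  have og: "orthogonal_transformation g"
    unfolding g_def by (intro orthogonal_transformation_compose reflection_orthogonal)
  have lin: "linear (reflection a)" for a :: "real^4"
    by (rule orthogonal_transformation_linear[OF reflection_orthogonal])
  have "matrix g = matrix (reflection (\<xi> - \<eta>)) ** matrix (reflection c)"
    unfolding g_def by (rule matrix_compose[OF lin lin])
  then have "det (matrix g) = (det (matrix (reflection c)))\<^sup>2"
    by (simp add: det_mul det_reflection_eq[OF nc] power2_eq_square)
  also have "\<dots> = 1"
    using det_orthogonal_matrix[of "matrix (reflection c)"] reflection_orthogonal[of c]
    by (auto simp: orthogonal_transformation_matrix)
  finally have rot: "rotation_matrix (matrix g)"
    using og by (simp add: rotation_matrix_def orthogonal_transformation_matrix)
  have "g e = e"
    using c assms by (simp add: g_def reflection_def inner_diff_left)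
  moreover have "g \<xi> = \<eta>"
    using c reflection_swap[OF assms(1)] by (simp add: g_def reflection_def[of c])
  moreover have "matrix g *v x = g x" for x
    using og by (simp add: matrix_works orthogonal_transformation_linear)
  ultimately show ?thesis using that rot by metis
qed

lemma revolution_radial_eq:
  assumes K: "body_of_revolution K" and \<xi>: "norm \<xi> = 1" "\<xi> $ 4 = 0"
  shows "radial_function K (sqrt (1 - t\<^sup>2) *\<^sub>R \<xi> + t *\<^sub>R axis 4 1) = revolution_radial K t"
proof -
  have *: "norm (axis 1 1 :: real^4) = norm \<xi>" "(axis 1 1 :: real^4) \<bullet> axis 4 1 = 0"
    "\<xi> \<bullet> axis 4 1 = 0"
    using \<xi> by (simp_all add: inner_axis) (simp add: axis_def)
  obtain Q :: "real^4^4" where Q: "rotation_matrix Q" "Q *v axis 4 1 = axis 4 1"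
    "Q *v axis 1 1 = \<xi>"
    by (rule rotation_fixing_axis_exists[OF *])
  have im: "(\<lambda>x. Q *v x) ` K = K" using K Q unfolding body_of_revolution_def by blast
  have "inj (\<lambda>x. Q *v x)"
    using Q(1) unfolding rotation_matrix_def
    by (metis matrix_left_invertible_injective orthogonal_matrix_def)
  then have mem: "Q *v x \<in> K \<longleftrightarrow> x \<in> K" for x
    using im by (metis image_iff injD)
  have "r *\<^sub>R (sqrt (1 - t\<^sup>2) *\<^sub>R \<xi> + t *\<^sub>R axis 4 1) =
      Q *v (r *\<^sub>R (sqrt (1 - t\<^sup>2) *\<^sub>R axis 1 1 + t *\<^sub>R axis 4 1))" for r
    by (simp add: Q matrix_vector_right_distrib matrix_vector_mult_scaleR)
  then show ?thesis unfolding revolution_radial_def radial_function_def by (simp add: mem)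
qed

text \<open>On an interval of positive length the derivatives at the endpoints are one-sided.\<close>

definition C2_on :: "real set \<Rightarrow> (real \<Rightarrow> real) \<Rightarrow> bool" where
  "C2_on S f \<longleftrightarrow> (\<exists>f' f''.
     (\<forall>t\<in>S. (f has_real_derivative f' t) (at t within S)) \<and>
     (\<forall>t\<in>S. (f' has_real_derivative f'' t) (at t within S)) \<and>
     continuous_on S f'')"

text \<open>The three-dimensional volume of a subset of a hyperplane is its Lebesgue measure after
  a linear isometric identification of the hyperplane with three-dimensional space; by
  \<open>hyperplane_volume_eq\<close> the choice of the identification is irrelevant.\<close>

definition hyperplane_isometry :: "real^4 \<Rightarrow> (real^3 \<Rightarrow> real^4) \<Rightarrow> bool" where
  "hyperplane_isometry \<xi> f \<longleftrightarrow>
     linear f \<and> (\<forall>y. norm (f y) = norm y) \<and> range f = {x. \<xi> \<bullet> x = 0}"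

definition hyperplane_volume :: "real^4 \<Rightarrow> (real^4) set \<Rightarrow> real" where
  "hyperplane_volume \<xi> A = measure lebesgue ((SOME f. hyperplane_isometry \<xi> f) -` A)"

definition intersection_body :: "(real^4) set \<Rightarrow> (real^4) set" where
  "intersection_body K =
     star_body_of (\<lambda>\<xi>. hyperplane_volume \<xi> (K \<inter> {x. \<xi> \<bullet> x = 0}))"

lemma hyperplane_isometry_exists:
  assumes "\<xi> \<noteq> 0"
  shows "\<exists>f. hyperplane_isometry \<xi> f"
proof -
  have d: "dim (UNIV :: (real^3) set) = dim {x. \<xi> \<bullet> x = 0}"
    using dim_hyperplane[OF assms] by (simp add: dim_UNIV)
  show ?thesis
    by (rule isometries_subspaces[OF subspace_UNIV subspace_hyperplane d])
       (auto simp: hyperplane_isometry_def)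
qed

lemma hyperplane_isometry_some:
  assumes "\<xi> \<noteq> 0"
  shows "hyperplane_isometry \<xi> (SOME f. hyperplane_isometry \<xi> f)"
  using hyperplane_isometry_exists[OF assms] by (rule someI_ex)

lemma hyperplane_volume_eq:
  assumes "\<xi> \<noteq> 0" and f: "hyperplane_isometry \<xi> f" and meas: "f -` A \<in> lmeasurable"
  shows "hyperplane_volume \<xi> A = measure lebesgue (f -` A)"
proof -
  define g where "g = (SOME f. hyperplane_isometry \<xi> f)"
  have g: "hyperplane_isometry \<xi> g"
    unfolding g_def by (rule hyperplane_isometry_some[OF assms(1)])
  have inj: "inj h" if "hyperplane_isometry \<xi> h" for h
  proof -
    have "linear h" and n: "norm (h y) = norm y" for y
      using that unfolding hyperplane_isometry_def by auto
    have "y = 0" if "h y = 0" for y using n[of y] that by simp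
    with \<open>linear h\<close> show ?thesis by (simp add: linear_injective_0)
  qed
  define h where "h y = inv g (f y)" for y
  have gh: "g (h y) = f y" for y
  proof -
    have "range f = range g" using f g by (simp add: hyperplane_isometry_def)
    then have "f y \<in> range g" by auto
    then show ?thesis unfolding h_def by (rule f_inv_into_f)
  qed
  have "linear h"
  proof (rule linearI)
    fix x y c
    show "h (x + y) = h x + h y"
      using f g by (intro injD[OF inj[OF g]])
        (simp add: gh linear_add hyperplane_isometry_def)
    show "h (c *\<^sub>R x) = c *\<^sub>R h x"
      using f g by (intro injD[OF inj[OF g]])
        (simp add: gh linear_scale hyperplane_isometry_def)
  qed
  moreover have "norm (h y) = norm y" for y
  proof -
    have "norm (g (h y)) = norm (h y)" "norm (f y) = norm y"
      using f g by (simp_all add: hyperplane_isometry_def)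
    with gh show ?thesis by simp
  qed
  ultimately have oh: "orthogonal_transformation h"
    unfolding orthogonal_transformation by blast
  have "h ` (f -` A) = g -` A"
  proof (intro equalityI subsetI)
    fix z assume z: "z \<in> g -` A"
    have "range g = range f" using f g by (simp add: hyperplane_isometry_def)
    then have "g z \<in> range f" by auto
    then obtain y where y: "g z = f y" by auto
    have "z = h y" by (rule injD[OF inj[OF g]]) (simp add: gh y)
    with z show "z \<in> h ` (f -` A)" using gh by auto
  qed (auto simp: gh)
  with measure_orthogonal_image[OF oh meas] show ?thesis
    unfolding hyperplane_volume_def g_def by simp
qed

lemma radial_function_intersection_body:
  assumes "norm \<xi> = 1"
  shows "radial_function (intersection_body K) \<xi> =
     hyperplane_volume \<xi> (K \<inter> {x. \<xi> \<bullet> x = 0})"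
  unfolding intersection_body_def
  by (rule radial_function_star_body_of[OF assms]) (simp add: hyperplane_volume_def)

lemma bounded_intersection_body:
  assumes "compact K"
  shows "bounded (intersection_body K)"
proof -
  obtain R where R: "\<And>x. x \<in> K \<Longrightarrow> norm x \<le> R"
    using compact_imp_bounded[OF assms] bounded_iff by blast
  have "hyperplane_volume \<xi> (K \<inter> {x. \<xi> \<bullet> x = 0}) \<le> measure lebesgue (cball (0 :: real^3) R)"
    if "norm \<xi> = 1" for \<xi> :: "real^4"
  proof -
    define f where "f = (SOME f. hyperplane_isometry \<xi> f)"
    have f: "hyperplane_isometry \<xi> f"
      unfolding f_def by (rule hyperplane_isometry_some) (use that in auto)
    then have lin: "linear f" and nf: "\<And>y. norm (f y) = norm y"
      unfolding hyperplane_isometry_def by auto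
    have cl: "closed (f -` (K \<inter> {x. \<xi> \<bullet> x = 0}))"
      using lin assms
      by (intro continuous_closed_vimage closed_Int compact_imp_closed closed_hyperplane)
         (auto simp: linear_continuous_at linear_conv_bounded_linear)
    have sub: "f -` (K \<inter> {x. \<xi> \<bullet> x = 0}) \<subseteq> cball 0 R"
      using R nf by (metis (no_types, lifting) IntD1 mem_cball_0 subsetI vimageD)
    have "measure lebesgue (f -` (K \<inter> {x. \<xi> \<bullet> x = 0})) \<le>
        measure lebesgue (cball (0 :: real^3) R)"
      by (rule measure_mono_fmeasurable[OF sub]) (use cl in auto)
    then show ?thesis unfolding hyperplane_volume_def f_def .
  qed
  then show ?thesis
    unfolding intersection_body_def star_body_of_def bounded_iff
    by (fastforce intro!: exI[of _ "measure lebesgue (cball (0 :: real^3) R)"])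
qed

definition zonoid :: "'a::euclidean_space set \<Rightarrow> bool" where
  "zonoid Z \<longleftrightarrow> Z \<noteq> {} \<and> compact Z \<and> convex Z \<and>
     (\<exists>\<mu> :: 'a measure.
        sets \<mu> = sets (restrict_space borel (sphere 0 1)) \<and>
        finite_measure \<mu> \<and>
        (\<forall>A\<in>sets \<mu>. emeasure \<mu> (uminus ` A) = emeasure \<mu> A) \<and>
        (\<forall>u\<in>sphere 0 1. support_function Z u = (\<integral>v. \<bar>u \<bullet> v\<bar> \<partial>\<mu>)))"

definition polar_zonoid :: "'a::euclidean_space set \<Rightarrow> bool" where
  "polar_zonoid L \<longleftrightarrow> convex_body L \<and> (\<exists>Z. zonoid Z \<and> L = polar_body Z)"

text \<open>For bounded sets, in particular for intersection bodies of convex bodies, the first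
  conjunct is automatic, so failing to be a polar zonoid is never due to a lack of convexity.\<close>

lemma polar_zonoid_iff:
  assumes "bounded L"
  shows "polar_zonoid L \<longleftrightarrow> (\<exists>Z. zonoid Z \<and> L = polar_body Z)"
proof -
  have "convex_body L" if "zonoid Z" and L: "L = polar_body Z" for Z
  proof -
    have eq: "L = (\<Inter>y\<in>Z. {x. y \<bullet> x \<le> 1})"
      unfolding L polar_body_def by (auto simp: inner_commute)
    have "closed L" unfolding eq by (intro closed_INT ballI closed_halfspace_le)
    then have "compact L" using assms compact_eq_bounded_closed by blast
    moreover have "convex L" unfolding eq by (intro convex_INT convex_halfspace_le)
    moreover have "interior L \<noteq> {}"
    proof -
      obtain R where R: "R > 0" "\<And>y. y \<in> Z \<Longrightarrow> norm y \<le> R"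
        using \<open>zonoid Z\<close> compact_imp_bounded bounded_pos unfolding zonoid_def by metis
      have "ball 0 (1 / R) \<subseteq> L"
      proof
        fix x :: 'a assume x: "x \<in> ball 0 (1 / R)"
        have "x \<bullet> y \<le> 1" if "y \<in> Z" for y
        proof -
          have "x \<bullet> y \<le> norm x * norm y" by (rule norm_cauchy_schwarz)
          also have "\<dots> \<le> (1 / R) * R" using x R that by (intro mult_mono) auto
          finally show ?thesis using R by simp
        qed
        then show "x \<in> L" unfolding L polar_body_def by blast
      qed
      with R show ?thesis
        by (metis centre_in_ball divide_pos_pos empty_iff interior_maximal open_ball subsetD
            zero_less_one)
    qed
    ultimately show ?thesis unfolding convex_body_def by blast
  qed
  then show ?thesis unfolding polar_zonoid_def by blast
qed

end

theory Submission
  imports Defs "HOL-Real_Asymp.Real_Asymp"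
begin

text \<open>
  Let \<open>F w\<close> be the integral of \<open>\<rho>\<^sub>K\<^sup>3\<close> over \<open>[0, w]\<close>. On \<open>S\<^sup>2\<close> the absolute cosine of the angle
  with a fixed axis is uniformly distributed on \<open>[0, 1]\<close> (Archimedes), so a hyperplane whose unit
  normal is at distance \<open>l\<close> from the axis of revolution cuts \<open>K\<close> in volume \<open>4 \<pi> F l / (3 l)\<close>.
  If \<open>IK\<close> were polar to a zonoid \<open>Z\<close>, the support function of \<open>Z\<close> at a point at distance \<open>1\<close>
  from the axis and height \<open>z\<close> would therefore be \<open>G z = 3 / (4 \<pi> F (1 / sqrt (1 + z\<^sup>2)))\<close>.

  By Archimedes' theorem again, averaging the cosine transform that represents this support
  function over the rotations writes \<open>G z\<close> as a superposition of the functions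
  \<open>\<integral>\<^sub>0\<^sup>1 max (a c) (b z) dc\<close>, which are quadratic in \<open>z\<close> up to \<open>z = a / b\<close> and linear
  afterwards; hence \<open>G (2 z) + 3 G 0 \<le> 4 G z\<close>. On the other hand
  \<open>\<rho>\<^sub>K'(1) = - \<rho>\<^sub>K(1)\<close> makes the fourth order term of \<open>F (1 / sqrt (1 + z\<^sup>2))\<close> vanish, so that the
  coefficient of \<open>z\<^sup>4\<close> in \<open>G\<close> is positive, which contradicts this inequality for small \<open>z\<close>.
\<close>

subsection \<open>Archimedes' theorem in three-dimensional space\<close>

lemma emeasure_lborel_annulus:
  fixes a b :: real
  assumes "0 \<le> a" "a \<le> b"
  shows "emeasure lborel {s :: real \<times> real. a \<le> norm s \<and> norm s \<le> b} = ennreal (pi * (b\<^sup>2 - a\<^sup>2))"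
proof -
  have eq: "{s :: real \<times> real. a \<le> norm s \<and> norm s \<le> b} = cball 0 b - ball 0 a" by auto
  have "emeasure lborel (cball 0 b - ball 0 a :: (real \<times> real) set) =
      emeasure lborel (cball 0 b :: (real \<times> real) set) - emeasure lborel (ball 0 a :: (real \<times> real) set)"
    using assms by (intro emeasure_Diff) (auto simp: emeasure_ball)
  also have "\<dots> = ennreal (pi * b\<^sup>2) - ennreal (pi * a\<^sup>2)"
    using assms by (simp add: emeasure_ball emeasure_cball unit_ball_vol_2 power2_eq_square)
  also have "\<dots> = ennreal (pi * b\<^sup>2 - pi * a\<^sup>2)"
    by (rule ennreal_minus) simp
  finally show ?thesis unfolding eq by (simp add: right_diff_distrib)
qed

text \<open>The slices perpendicular to the first axis are annuli with squared radii
  \<open>x\<^sup>2 / c\<^sup>2 - x\<^sup>2\<close> and \<open>R\<^sup>2 - x\<^sup>2\<close>. The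
  terms \<open>x\<^sup>2\<close> cancel in the area, and the volume comes out linear in
  \<open>c\<close>: Archimedes' theorem in solid form.\<close>

lemma emeasure_lborel_double_sector_prod:
  fixes c R :: real
  assumes "0 \<le> c" "c \<le> 1" "0 \<le> R"
  shows "emeasure lborel {v :: real \<times> real \<times> real. norm v \<le> R \<and> \<bar>fst v\<bar> \<le> c * norm v} =
    ennreal (4 * pi / 3 * R ^ 3 * c)"
proof (cases "c = 0")
  \<comment> \<open>For \<open>c = 0\<close> the inner radius makes no sense, but the set lies in a
    plane and is null.\<close>
  case True
  have "emeasure lborel {v :: real \<times> real \<times> real. norm v \<le> R \<and> \<bar>fst v\<bar> \<le> c * norm v}
      \<le> emeasure (lborel \<Otimes>\<^sub>M lborel) ({0 :: real} \<times> (UNIV :: (real \<times> real) set))"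
    unfolding lborel_prod by (intro emeasure_mono) (auto simp: True intro!: borel_closed closed_Times)
  also have "\<dots> = 0" by (subst lborel.emeasure_pair_measure_Times) auto
  finally show ?thesis by (simp add: True)
next
  case False
  with assms have c: "0 < c" by simp
  let ?S = "{v :: real \<times> real \<times> real. norm v \<le> R \<and> \<bar>fst v\<bar> \<le> c * norm v}"
  have meas: "?S \<in> sets (lborel \<Otimes>\<^sub>M lborel)"
    unfolding lborel_prod sets_lborel
    by (intro borel_closed closed_Collect_conj closed_Collect_le continuous_intros)
  have slice: "emeasure lborel (Pair x -` ?S) =
      ennreal (pi * (R\<^sup>2 - x\<^sup>2 / c\<^sup>2)) * indicator {- (c * R)..c * R} x" for x
  proof (cases "x \<in> {- (c * R)..c * R}")
    case True
    then have "x\<^sup>2 \<le> (c * R)\<^sup>2" by (intro power2_le_iff_abs_le[THEN iffD2]) auto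
    then have x: "x\<^sup>2 / c\<^sup>2 \<le> R\<^sup>2" using c by (simp add: field_simps power_mult_distrib)
    have "c\<^sup>2 \<le> 1" using assms c by (simp add: power_le_one)
    then have "x\<^sup>2 * c\<^sup>2 \<le> x\<^sup>2 * 1" by (intro mult_left_mono) auto
    then have x0: "x\<^sup>2 \<le> x\<^sup>2 / c\<^sup>2" using c by (simp add: field_simps)
    have "Pair x -` ?S = {s. sqrt (x\<^sup>2 / c\<^sup>2 - x\<^sup>2) \<le> norm s \<and> norm s \<le> sqrt (R\<^sup>2 - x\<^sup>2)}"
    proof -
      have "norm (x, s) \<le> R \<longleftrightarrow> norm s \<le> sqrt (R\<^sup>2 - x\<^sup>2)" for s :: "real \<times> real"
      proof -
        have "norm (x, s) \<le> R \<longleftrightarrow> (norm (x, s))\<^sup>2 \<le> R\<^sup>2" using assms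
          by (simp add: abs_le_square_iff[symmetric])
        also have "\<dots> \<longleftrightarrow> (norm s)\<^sup>2 \<le> R\<^sup>2 - x\<^sup>2" by (auto simp: norm_Pair)
        also have "\<dots> \<longleftrightarrow> norm s \<le> sqrt (R\<^sup>2 - x\<^sup>2)"
          by (metis norm_ge_zero real_le_rsqrt real_sqrt_le_iff real_sqrt_unique)
        finally show ?thesis .
      qed
      moreover have "\<bar>x\<bar> \<le> c * norm (x, s) \<longleftrightarrow> sqrt (x\<^sup>2 / c\<^sup>2 - x\<^sup>2) \<le> norm s" for s :: "real \<times> real"
      proof -
        have "\<bar>x\<bar> \<le> c * norm (x, s) \<longleftrightarrow> x\<^sup>2 \<le> (c * norm (x, s))\<^sup>2" using c
          by (simp add: abs_le_square_iff[symmetric] abs_mult)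
        also have "\<dots> \<longleftrightarrow> x\<^sup>2 / c\<^sup>2 - x\<^sup>2 \<le> (norm s)\<^sup>2" using c
          by (simp add: norm_Pair power_mult_distrib field_simps)
        also have "\<dots> \<longleftrightarrow> sqrt (x\<^sup>2 / c\<^sup>2 - x\<^sup>2) \<le> norm s"
          by (metis norm_ge_zero real_le_lsqrt real_sqrt_le_iff real_sqrt_unique)
        finally show ?thesis .
      qed
      ultimately show ?thesis by auto
    qed
    moreover have "emeasure lborel \<dots> = ennreal (pi * ((sqrt (R\<^sup>2 - x\<^sup>2))\<^sup>2 - (sqrt (x\<^sup>2 / c\<^sup>2 - x\<^sup>2))\<^sup>2))"
      using x x0 by (intro emeasure_lborel_annulus) auto
    ultimately show ?thesis using True x x0 by simp
  next
    case False
    have empty: "Pair x -` ?S = {}"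
    proof -
      have "\<bar>x\<bar> \<le> c * R" if "norm (x, s) \<le> R" "\<bar>x\<bar> \<le> c * norm (x, s)" for s :: "real \<times> real"
        using that c by (meson mult_left_mono less_imp_le order_trans)
      then show ?thesis using False by (fastforce simp: abs_le_iff)
    qed
    show ?thesis unfolding empty using False by simp
  qed
  have "emeasure lborel ?S = emeasure (lborel \<Otimes>\<^sub>M lborel) ?S" by (simp add: lborel_prod)
  also have "\<dots> = (\<integral>\<^sup>+x. ennreal (pi * (R\<^sup>2 - x\<^sup>2 / c\<^sup>2)) * indicator {- (c * R)..c * R} x \<partial>lborel)"
    unfolding lborel.emeasure_pair_measure_alt[OF meas] slice ..
  also have "\<dots> = ennreal (pi * (R\<^sup>2 * (c * R) - (c * R) ^ 3 / (3 * c\<^sup>2)) -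
      pi * (R\<^sup>2 * (- (c * R)) - (- (c * R)) ^ 3 / (3 * c\<^sup>2)))"
  proof (rule nn_integral_FTC_Icc[where F = "\<lambda>x. pi * (R\<^sup>2 * x - x ^ 3 / (3 * c\<^sup>2))"])
    show "((\<lambda>x. pi * (R\<^sup>2 * x - x ^ 3 / (3 * c\<^sup>2))) has_real_derivative pi * (R\<^sup>2 - x\<^sup>2 / c\<^sup>2)) (at x)" for x
      using c
      by (auto intro!: derivative_eq_intros simp: field_simps power2_eq_square)
    show "0 \<le> pi * (R\<^sup>2 - x\<^sup>2 / c\<^sup>2)" if "x \<in> {- (c * R)..c * R}" for x
    proof -
      have "x\<^sup>2 \<le> (c * R)\<^sup>2" using that by (intro power2_le_iff_abs_le[THEN iffD2]) auto
      then show ?thesis using c by (simp add: field_simps power_mult_distrib)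
    qed
  qed (use c assms in auto)
  also have "\<dots> = ennreal (4 * pi / 3 * R ^ 3 * c)"
    using c by (intro arg_cong[of _ _ ennreal]) (simp add: field_simps power2_eq_square power3_eq_cube)
  finally show ?thesis .
qed

text \<open>Slicing takes place in an iterated product of lines, whereas hyperplane sections are
  identified with \<open>real ^ 3\<close>; this linear isometry carries volumes across.\<close>

definition real3_of_prod :: "real \<times> real \<times> real \<Rightarrow> real ^ 3" where
  "real3_of_prod v = vector [fst v, fst (snd v), snd (snd v)]"

lemma norm_real3_of_prod [simp]: "norm (real3_of_prod v) = norm v"
  by (cases v) (simp add: real3_of_prod_def norm_vec_def L2_set_def sum_3 norm_Pair add.assoc)

lemma real3_of_prod_1 [simp]: "real3_of_prod v $ 1 = fst v"
  by (simp add: real3_of_prod_def)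

lemma linear_real3_of_prod: "linear real3_of_prod"
  by (rule linearI) (auto simp: real3_of_prod_def vec_eq_iff forall_3)

lemma borel_measurable_real3_of_prod [measurable]: "real3_of_prod \<in> borel_measurable borel"
  by (intro borel_measurable_continuous_onI linear_continuous_on)
     (simp add: linear_real3_of_prod linear_conv_bounded_linear[symmetric])

lemma distr_lborel_real3_of_prod: "distr lborel borel real3_of_prod = lborel"
proof (rule lborel_eqI[symmetric])
  fix l u :: "real ^ 3"
  assume le: "\<And>b. b \<in> Basis \<Longrightarrow> l \<bullet> b \<le> u \<bullet> b"
  have le': "l $ i \<le> u $ i" for i
    using le[of "axis i 1"] by (simp add: inner_axis axis_in_Basis_iff)
  have "real3_of_prod -` box l u = {l $ 1<..<u $ 1} \<times> {l $ 2<..<u $ 2} \<times> {l $ 3<..<u $ 3}"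
    by (auto simp: mem_box_cart real3_of_prod_def forall_3)
  then have "emeasure (distr lborel borel real3_of_prod) (box l u) =
      emeasure (lborel \<Otimes>\<^sub>M (lborel \<Otimes>\<^sub>M lborel)) ({l $ 1<..<u $ 1} \<times> {l $ 2<..<u $ 2} \<times> {l $ 3<..<u $ 3})"
    by (subst emeasure_distr) (simp_all add: lborel_prod)
  also have "\<dots> = ennreal (u $ 1 - l $ 1) * (ennreal (u $ 2 - l $ 2) * ennreal (u $ 3 - l $ 3))"
    using le' by (simp add: lborel.emeasure_pair_measure_Times lborel_pair.sigma_finite_measure_axioms
      sigma_finite_measure.emeasure_pair_measure_Times)
  also have "\<dots> = ennreal ((u $ 1 - l $ 1) * (u $ 2 - l $ 2) * (u $ 3 - l $ 3))"
    using le' by (simp add: ennreal_mult mult.assoc)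
  also have "(u $ 1 - l $ 1) * (u $ 2 - l $ 2) * (u $ 3 - l $ 3) = (\<Prod>b\<in>Basis. (u - l) \<bullet> b)"
  proof -
    have B: "(Basis :: (real^3) set) = (\<lambda>i. axis i 1) ` UNIV"
      by (auto simp: Basis_vec_def)
    have inj: "inj (\<lambda>i :: 3. axis i (1 :: real))" by (auto simp: inj_def axis_eq_axis)
    show ?thesis
      unfolding B prod.reindex[OF inj] UNIV_3 by (simp add: inner_axis axis_eq_axis mult.assoc)
  qed
  finally show "emeasure (distr lborel borel real3_of_prod) (box l u) = ennreal (\<Prod>b\<in>Basis. (u - l) \<bullet> b)" .
qed simp

text \<open>Volume is invariant under an orthogonal map taking the first coordinate axis to
  \<open>q\<close>, so the axis case, settled by slicing, suffices.\<close>

lemma emeasure_lborel_double_sector: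
  fixes q :: "real ^ 3" and c R :: real
  assumes "norm q = 1" "0 \<le> c" "c \<le> 1" "0 \<le> R"
  shows "emeasure lborel {y. norm y \<le> R \<and> \<bar>q \<bullet> y\<bar> \<le> c * norm y} = ennreal (4 * pi / 3 * R ^ 3 * c)"
proof -
  let ?S = "\<lambda>q :: real ^ 3. {y. norm y \<le> R \<and> \<bar>q \<bullet> y\<bar> \<le> c * norm y}"
  have closed: "closed (?S q)" for q :: "real ^ 3"
    by (intro closed_Collect_conj closed_Collect_le continuous_intros)
  have meas: "?S q \<in> lmeasurable" for q :: "real ^ 3"
    by (intro bounded_set_imp_lmeasurable boundedI[of _ R] lborelD)
       (use closed in \<open>auto intro: borel_closed\<close>)
  have "emeasure lborel (?S (axis 1 1)) = emeasure (distr lborel borel real3_of_prod) (?S (axis 1 1))"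
    by (simp add: distr_lborel_real3_of_prod)
  also have "\<dots> = emeasure lborel {v :: real \<times> real \<times> real. norm v \<le> R \<and> \<bar>fst v\<bar> \<le> c * norm v}"
    using closed[of "axis 1 1"] by (subst emeasure_distr) (auto simp: inner_axis' intro: borel_closed)
  also have "\<dots> = ennreal (4 * pi / 3 * R ^ 3 * c)"
    by (rule emeasure_lborel_double_sector_prod) fact+
  finally have e1: "emeasure lborel (?S (axis 1 1)) = ennreal (4 * pi / 3 * R ^ 3 * c)" .
  have "norm (axis 1 1 :: real ^ 3) = norm q" by (simp add: assms norm_axis_1)
  then obtain f :: "real ^ 3 \<Rightarrow> real ^ 3" where f: "orthogonal_transformation f" "f (axis 1 1) = q"
    using orthogonal_transformation_exists by blast
  have inv: "orthogonal_transformation (inv f)" "surj f"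
    using f(1) orthogonal_transformation_inv orthogonal_transformation_surj by blast+
  have "f y \<in> ?S q \<longleftrightarrow> y \<in> ?S (axis 1 1)" for y
    using f orthogonal_transformation_norm[OF f(1)] by (auto simp: orthogonal_transformation_def)
  then have img: "f ` ?S (axis 1 1) = ?S q"
    using inv(2) by (auto simp: image_iff) (metis surjD)
  have "measure lebesgue (?S q) = measure lebesgue (?S (axis 1 1))"
    using measure_orthogonal_image[OF f(1) meas[of "axis 1 1"]] unfolding img .
  then have "emeasure lebesgue (?S q) = emeasure lebesgue (?S (axis 1 1))"
    using meas by (simp add: emeasure_eq_measure2)
  then show ?thesis using e1 closed by (simp add: borel_closed)
qed

section \<open>Joint distribution of norm and latitude\<close>

definition unif01 :: "real measure" where
  "unif01 = density lborel (indicator {0..1})"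

lemma sets_unif01 [measurable_cong, simp]: "sets unif01 = sets borel"
  and space_unif01 [simp]: "space unif01 = UNIV"
  by (simp_all add: unif01_def)

lemma emeasure_unif01:
  "A \<in> sets borel \<Longrightarrow> emeasure unif01 A = emeasure lborel ({0..1} \<inter> A)"
  unfolding unif01_def by (subst emeasure_density) (simp_all add: Int_commute indicator_inter_arith[symmetric])

lemma nn_integral_unif01:
  "f \<in> borel_measurable borel \<Longrightarrow> (\<integral>\<^sup>+c. f c \<partial>unif01) = (\<integral>\<^sup>+c. indicator {0..1} c * f c \<partial>lborel)"
  unfolding unif01_def by (subst nn_integral_density) simp_all

lemma finite_measure_unif01: "finite_measure unif01"
  by (rule finite_measureI) (simp add: emeasure_unif01)

lemma sigma_finite_distr_norm:
  "sigma_finite_measure (distr lborel borel (norm :: 'a :: euclidean_space \<Rightarrow> real))" (is "sigma_finite_measure ?M")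
proof (rule sigma_finite_measure.intro, intro exI conjI)
  let ?A = "range (\<lambda>n. {..real n})"
  show "countable ?A" by simp
  show "?A \<subseteq> sets ?M" by auto
  show "\<Union> ?A = space ?M" by (auto simp: real_arch_simple)
  have "norm -` {..r} = cball (0 :: 'a) r" for r by auto
  then show "\<forall>a\<in>?A. emeasure ?M a \<noteq> \<infinity>"
    by (auto simp: emeasure_distr emeasure_cball)
qed

text \<open>A quadrant with corner \<open>(R, c)\<close> pulls back to a double sector, whose volume
  factors into that of a ball and \<open>min 1 c\<close>. So norm and absolute cosine behave like
  independent variables, the cosine being uniform; quadrants form an intersection-stable generator,
  which extends this to all Borel sets.\<close>

lemma distr_norm_latitude:
  fixes q :: "real ^ 3"
  assumes q: "norm q = 1"
  shows "distr lborel (borel \<Otimes>\<^sub>M borel) (\<lambda>y. (norm y, \<bar>q \<bullet> y\<bar> / norm y)) =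
    distr lborel borel (norm :: real ^ 3 \<Rightarrow> real) \<Otimes>\<^sub>M unif01" (is "?N = ?M \<Otimes>\<^sub>M _")
proof (rule measure_eqI_generator_eq)
  interpret finite_measure unif01 by (rule finite_measure_unif01)
  let ?E = "range (\<lambda>a :: real \<times> real. {..a})"
  have E: "{..a :: real \<times> real} = {..fst a} \<times> {..snd a}" for a
    by (auto simp: less_eq_prod_def)
  show "Int_stable ?E"
    by (auto simp: Int_stable_def E Times_Int_Times Int_atMost intro!: image_eqI[of _ _ "(min a b, min c d)" for a b c d])
  show sets: "sets ?N = sigma_sets UNIV ?E"
  proof -
    have "sets ?N = sets (borel :: (real \<times> real) measure)" by (simp add: borel_prod)
    also have "\<dots> = sigma_sets UNIV ?E" by (subst borel_eq_atMost) simp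
    finally show ?thesis .
  qed
  have "sets (?M \<Otimes>\<^sub>M unif01) = sets (borel \<Otimes>\<^sub>M borel)"
    by (rule sets_pair_measure_cong) simp_all
  then show "sets (?M \<Otimes>\<^sub>M unif01) = sigma_sets UNIV ?E"
    using sets by simp
  let ?A = "\<lambda>n. {..(real n, real n)}"
  have N: "emeasure ?N {..a} = emeasure lborel {y. norm y \<le> fst a \<and> \<bar>q \<bullet> y\<bar> / norm y \<le> snd a}" for a
    by (subst emeasure_distr) (auto simp: E vimage_def)
  have M: "emeasure ?M {..r} = emeasure lborel (cball (0 :: real ^ 3) r)" for r
    by (subst emeasure_distr) (auto intro!: arg_cong[of _ _ "emeasure lborel"])
  have M': "emeasure (?M \<Otimes>\<^sub>M unif01) {..a} =
      emeasure lborel (cball (0 :: real ^ 3) (fst a)) * emeasure lborel {0..min 1 (snd a)}" for a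
    unfolding E by (subst emeasure_pair_measure_Times) (auto simp: M emeasure_unif01 Int_atMost intro!: arg_cong[of _ _ "emeasure lborel"])
  show "range ?A \<subseteq> ?E" by auto
  show "(\<Union>i. ?A i) = UNIV"
  proof -
    have "\<exists>n. a \<le> real n \<and> b \<le> real n" for a b
      using real_arch_simple[of "max a b"] by auto
    then show ?thesis by (auto simp: E)
  qed
  show "emeasure ?N (?A i) \<noteq> \<infinity>" for i
  proof -
    have "emeasure ?N (?A i) \<le> emeasure lborel (cball (0 :: real ^ 3) (real i))"
      unfolding N by (intro emeasure_mono) auto
    also have "\<dots> < \<infinity>" by (simp add: emeasure_cball)
    finally show ?thesis by simp
  qed
  fix X assume "X \<in> ?E"
  then obtain R c where X: "X = {..(R, c)}" by (auto simp: image_iff)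
  \<comment> \<open>By Cauchy-Schwarz the quotient never exceeds \<open>1\<close>, hence the cap
    \<open>min 1 c\<close>. At \<open>y = 0\<close> the quotient is \<open>0 / 0 = 0\<close>, which
    agrees with the condition on the right when \<open>c\<close> is nonnegative.\<close>
  have "{y. norm y \<le> R \<and> \<bar>q \<bullet> y\<bar> / norm y \<le> c} =
      (if R < 0 \<or> c < 0 then {} else {y. norm y \<le> R \<and> \<bar>q \<bullet> y\<bar> \<le> min 1 c * norm y})" (is "?L = ?R")
  proof (cases "R < 0 \<or> c < 0")
    case True
    have "0 \<le> norm y" "0 \<le> \<bar>q \<bullet> y\<bar> / norm y" for y by auto
    then have "?L = {}" using True by (smt (verit) Collect_empty_eq)
    with True show ?thesis by simp
  next
    case False
    have "\<bar>q \<bullet> y\<bar> / norm y \<le> c \<longleftrightarrow> \<bar>q \<bullet> y\<bar> \<le> min 1 c * norm y" for y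
    proof (cases "y = 0")
      case False
      have "\<bar>q \<bullet> y\<bar> \<le> norm y" using Cauchy_Schwarz_ineq2[of q y] q by simp
      moreover from this have "\<bar>q \<bullet> y\<bar> \<le> c * norm y" if "1 \<le> c"
        using mult_right_mono[OF that norm_ge_zero[of y]] by simp
      ultimately show ?thesis using False by (auto simp: min_def field_simps)
    qed (use False in auto)
    with False show ?thesis by simp
  qed
  then show "emeasure ?N X = emeasure (?M \<Otimes>\<^sub>M unif01) X"
    unfolding X N M' using emeasure_lborel_double_sector[OF q, of "min 1 c" R]
    by (auto simp: emeasure_cball unit_ball_vol_3 ennreal_mult'[symmetric] mult_ac)
qed auto

text \<open>Polar coordinates: at fixed latitude \<open>c\<close> the admissible norms are those of
  a ball of radius \<open>g c\<close>, and its volume is integrated over the uniform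
  \<open>c\<close>. Central sections of a body of revolution are sets of this form.\<close>

lemma emeasure_lborel_radial_graph:
  fixes q :: "real ^ 3"
  assumes q: "norm q = 1" and g [measurable]: "g \<in> borel_measurable borel"
    and g0: "\<And>c. 0 \<le> c \<Longrightarrow> c \<le> 1 \<Longrightarrow> 0 \<le> g c"
  shows "emeasure lborel {y. norm y \<le> g (\<bar>q \<bullet> y\<bar> / norm y)} =
    (\<integral>\<^sup>+c\<in>{0..1}. ennreal (4 * pi / 3 * g c ^ 3) \<partial>lborel)"
proof -
  let ?M = "distr lborel borel (norm :: real ^ 3 \<Rightarrow> real)"
  interpret M: sigma_finite_measure ?M by (rule sigma_finite_distr_norm)
  interpret U: finite_measure unif01 by (rule finite_measure_unif01)
  interpret pair_sigma_finite ?M unif01 ..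
  let ?X = "{(r, c). r \<le> g c}"
  have sets: "sets (?M \<Otimes>\<^sub>M unif01) = sets (borel \<Otimes>\<^sub>M borel)"
    by (rule sets_pair_measure_cong) simp_all
  have "{p \<in> space (borel \<Otimes>\<^sub>M borel). fst p \<le> g (snd p)} \<in> sets (borel \<Otimes>\<^sub>M borel)" by measurable
  then have X: "?X \<in> sets (borel \<Otimes>\<^sub>M borel)"
    by (simp add: space_pair_measure case_prod_unfold)
  have "emeasure lborel {y. norm y \<le> g (\<bar>q \<bullet> y\<bar> / norm y)} = emeasure (?M \<Otimes>\<^sub>M unif01) ?X"
    unfolding distr_norm_latitude[OF q, symmetric] using X by (subst emeasure_distr) (auto simp: vimage_def)
  also have "\<dots> = (\<integral>\<^sup>+c. emeasure ?M ((\<lambda>r. (r, c)) -` ?X) \<partial>unif01)"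
    using X by (intro emeasure_pair_measure_alt2) (simp add: sets)
  also have "\<dots> = (\<integral>\<^sup>+c. emeasure lborel (cball (0 :: real ^ 3) (g c)) \<partial>unif01)"
    by (intro nn_integral_cong) (subst emeasure_distr, auto simp: vimage_def intro!: arg_cong[of _ _ "emeasure lborel"])
  \<comment> \<open>Outside \<open>{0..1}\<close> the value \<open>g c\<close> may be negative and
    the ball empty; the conditional records this and disappears once \<open>unif01\<close> restricts
    \<open>c\<close>.\<close>
  also have "\<dots> = (\<integral>\<^sup>+c. ennreal (4 * pi / 3 * (if 0 \<le> g c then g c ^ 3 else 0)) \<partial>unif01)"
    by (intro nn_integral_cong) (auto simp: emeasure_cball unit_ball_vol_3)
  also have "\<dots> = (\<integral>\<^sup>+c\<in>{0..1}. ennreal (4 * pi / 3 * g c ^ 3) \<partial>lborel)"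
    by (subst nn_integral_unif01) (auto intro!: nn_integral_cong simp: g0 indicator_def)
  finally show ?thesis .
qed

text \<open>A mean over the sphere is expressed as an integral over the unit ball of a function of
  the direction alone. The norm then contributes only the volume of the ball.\<close>

lemma nn_integral_cball_latitude:
  fixes q :: "real ^ 3"
  assumes q: "norm q = 1" and h [measurable]: "h \<in> borel_measurable borel"
  shows "(\<integral>\<^sup>+y\<in>cball 0 1. h (\<bar>q \<bullet> y\<bar> / norm y) \<partial>lborel) =
    ennreal (4 * pi / 3) * (\<integral>\<^sup>+c\<in>{0..1}. h c \<partial>lborel)"
proof -
  let ?M = "distr lborel borel (norm :: real ^ 3 \<Rightarrow> real)"
  interpret U: finite_measure unif01 by (rule finite_measure_unif01)
  have sets [measurable_cong]: "sets (?M \<Otimes>\<^sub>M unif01) = sets (borel \<Otimes>\<^sub>M borel)"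
    by (rule sets_pair_measure_cong) simp_all
  have "(\<integral>\<^sup>+y\<in>cball 0 1. h (\<bar>q \<bullet> y\<bar> / norm y) \<partial>lborel) =
      (\<integral>\<^sup>+p. indicator {..1} (fst p) * h (snd p) \<partial>distr lborel (borel \<Otimes>\<^sub>M borel) (\<lambda>y. (norm y, \<bar>q \<bullet> y\<bar> / norm y)))"
    by (subst nn_integral_distr) (auto intro!: nn_integral_cong simp: indicator_def)
  also have "\<dots> = (\<integral>\<^sup>+r. \<integral>\<^sup>+c. indicator {..1} r * h c \<partial>unif01 \<partial>?M)"
    unfolding distr_norm_latitude[OF q] by (subst U.nn_integral_fst[symmetric]) simp_all
  also have "\<dots> = emeasure ?M {..1} * (\<integral>\<^sup>+c. h c \<partial>unif01)"
    by (simp add: nn_integral_cmult nn_integral_multc)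
  also have "emeasure ?M {..1} = emeasure lborel (cball (0 :: real ^ 3) 1)"
    by (subst emeasure_distr) (auto intro!: arg_cong[of _ _ "emeasure lborel"])
  finally show ?thesis
    by (simp add: emeasure_cball unit_ball_vol_3 nn_integral_unif01 mult.commute)
qed

subsection \<open>Averaged cosine transforms\<close>

lemma has_real_derivative_mult_abs:
  "((\<lambda>x :: real. x * \<bar>x\<bar>) has_real_derivative 2 * \<bar>x\<bar>) (at x)"
proof (cases "x = 0")
  case True
  have "(\<lambda>h :: real. ((0 + h) * \<bar>0 + h\<bar> - 0 * \<bar>0\<bar>) / h) = abs" by auto
  moreover have "((\<lambda>h :: real. \<bar>h\<bar>) \<longlongrightarrow> 0) (at 0)"
    by (auto intro!: tendsto_eq_intros)
  ultimately show ?thesis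
    unfolding True DERIV_def by simp
next
  case False
  then consider "x > 0" | "x < 0" by linarith
  then show ?thesis
  proof cases
    case 1
    have "((\<lambda>x. x * x) has_real_derivative 2 * \<bar>x\<bar>) (at x)"
      using 1 by (auto intro!: derivative_eq_intros)
    then show ?thesis
      by (rule has_field_derivative_transform_within_open[where S = "{0<..}"]) (use 1 in auto)
  next
    case 2
    have "((\<lambda>x. - (x * x)) has_real_derivative 2 * \<bar>x\<bar>) (at x)"
      using 2 by (auto intro!: derivative_eq_intros)
    then show ?thesis
      by (rule has_field_derivative_transform_within_open[where S = "{..<0}"]) (use 2 in auto)
  qed
qed

text \<open>For \<open>a = w = 0\<close> the first branch is \<open>0 / 0 = 0\<close>, which is the right value.\<close>

definition max_integral :: "real \<Rightarrow> real \<Rightarrow> real" where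
  "max_integral a w = (if w \<le> a then a / 2 + w\<^sup>2 / (2 * a) else w)"

lemma nn_integral_max:
  fixes a w :: real
  assumes "0 \<le> a" "0 \<le> w"
  shows "(\<integral>\<^sup>+c\<in>{0..1}. ennreal (max (a * c) w) \<partial>lborel) = ennreal (max_integral a w)"
proof (cases "a = 0")
  case True
  then show ?thesis using assms by (simp add: max_integral_def nn_integral_cmult_indicator)
next
  case False
  with assms have a: "0 < a" by simp
  \<comment> \<open>The integrand equals \<open>(a * c + w + \<bar>a * c - w\<bar>) / 2\<close>.
    Since \<open>Q\<close> has derivative \<open>2 * a * \<bar>a * c - w\<bar>\<close>,
    \<open>P\<close> is one antiderivative valid on both sides of the kink at
    \<open>c = w / a\<close>.\<close>
  define Q where "Q c = (a * c - w) * \<bar>a * c - w\<bar>" for c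
  define P where "P c = a * c\<^sup>2 / 4 + w * c / 2 + Q c / (4 * a)" for c
  have "(P has_real_derivative max (a * c) w) (at c)" for c
  proof -
    have "(Q has_real_derivative 2 * \<bar>a * c - w\<bar> * a) (at c)"
      unfolding Q_def
      by (rule DERIV_chain'[where f = "\<lambda>c. a * c - w" and g = "\<lambda>x. x * \<bar>x\<bar>", OF _ has_real_derivative_mult_abs])
         (auto intro!: derivative_eq_intros)
    then have "(P has_real_derivative a * (2 * c) / 4 + w / 2 + 2 * \<bar>a * c - w\<bar> * a / (4 * a)) (at c)"
      unfolding P_def
      by (intro DERIV_add DERIV_cdivide) (auto intro!: derivative_eq_intros)
    then show ?thesis
      by (rule DERIV_cong) (use a in \<open>simp add: max_def field_simps\<close>)
  qed
  then have "(\<integral>\<^sup>+c\<in>{0..1}. ennreal (max (a * c) w) \<partial>lborel) = ennreal (P 1 - P 0)"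
    using assms by (intro nn_integral_FTC_Icc)
      (auto simp: le_max_iff_disj)
  also have "P 1 - P 0 = max_integral a w"
    using a assms by (auto simp: P_def Q_def max_integral_def abs_if field_simps power2_eq_square)
  finally show ?thesis .
qed

text \<open>A quadratic without linear term gives equality, which settles
  \<open>2 * w \<le> a\<close>. For \<open>w \<le> a < 2 * w\<close> the defect is
  \<open>(a - 2 * w)\<^sup>2 / (2 * a)\<close>, and for \<open>a < w\<close> the claim reduces to
  \<open>3 * a / 2 \<le> 2 * w\<close>.\<close>

lemma max_integral_double:
  assumes "0 \<le> a" "0 \<le> w"
  shows "max_integral a (2 * w) + 3 * max_integral a 0 \<le> 4 * max_integral a w"
proof (cases "a = 0")
  case False
  with assms have a: "0 < a" by simp
  have "0 \<le> (a - 2 * w)\<^sup>2 / a" using a by simp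
  also have "\<dots> = a - 4 * w + 4 * w\<^sup>2 / a"
    using a by (simp add: field_simps power2_eq_square)
  finally show ?thesis using a assms by (auto simp: max_integral_def power_mult_distrib)
qed (use assms in \<open>auto simp: max_integral_def\<close>)

text \<open>With \<open>p\<close> written as \<open>norm p\<close> times a unit vector, Archimedes'
  theorem turns \<open>I w\<close> into a multiple of \<open>max_integral (norm p) w\<close>, to
  which the scalar inequality applies.\<close>

lemma nn_integral_cball_max_double:
  fixes p :: "real ^ 3"
  assumes "0 \<le> w"
  defines "I \<equiv> \<lambda>w. \<integral>\<^sup>+y\<in>cball 0 1. ennreal (max (\<bar>p \<bullet> y\<bar> / norm y) w) \<partial>lborel"
  shows "I (2 * w) + 3 * I 0 \<le> 4 * I w"
proof -
  obtain q where q: "norm q = 1" "p = norm p *\<^sub>R q"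
  proof (cases "p = 0")
    case True
    then show ?thesis using that[of "axis 1 1"] norm_axis_1 by simp
  qed (rule that[of "sgn p"], auto simp: norm_sgn sgn_div_norm)
  define a where "a = norm p"
  have *: "\<bar>p \<bullet> y\<bar> = a * \<bar>q \<bullet> y\<bar>" for y
    by (subst q(2)) (simp add: a_def abs_mult)
  have I: "I w = ennreal (4 * pi / 3 * max_integral a w)" if "0 \<le> w" for w
  proof -
    have "I w = (\<integral>\<^sup>+y\<in>cball 0 1. ennreal (max (a * (\<bar>q \<bullet> y\<bar> / norm y)) w) \<partial>lborel)"
      by (simp add: I_def *)
    also have "\<dots> = ennreal (4 * pi / 3) * (\<integral>\<^sup>+c\<in>{0..1}. ennreal (max (a * c) w) \<partial>lborel)"
      by (rule nn_integral_cball_latitude[OF q(1)]) measurable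
    finally show ?thesis
      using nn_integral_max[of a w] that by (simp add: a_def ennreal_mult'[symmetric])
  qed
  have nonneg: "0 \<le> max_integral a w" if "0 \<le> w" for w
    using that by (auto simp: max_integral_def a_def)
  have "I (2 * w) + 3 * I 0 = ennreal (4 * pi / 3 * (max_integral a (2 * w) + 3 * max_integral a 0))"
    using assms(1) nonneg
    by (simp add: I distrib_left ennreal_mult'[symmetric] flip: ennreal_plus ennreal_numeral)
  also have "\<dots> \<le> ennreal (4 * pi / 3 * (4 * max_integral a w))"
    using max_integral_double[of a w] assms by (intro ennreal_leI mult_left_mono) (auto simp: a_def)
  also have "\<dots> = 4 * I w"
    using assms(1) nonneg by (simp add: I mult_ac flip: ennreal_mult' ennreal_numeral)
  finally show ?thesis .
qed

text \<open>Since \<open>avg\<close> has the same right side for every unit vector \<open>y\<close>,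
  averaging over \<open>y\<close> changes nothing but a constant. After Fubini the inner integral,
  for fixed \<open>v\<close>, is one for which the inequality is known, and it is then integrated
  against \<open>\<mu>\<close>. In the application \<open>e\<close> spans the axis and
  \<open>g\<close> embeds its orthogonal complement.\<close>

lemma zonoid_average_double:
  fixes \<mu> :: "'a :: euclidean_space measure" and g :: "real ^ 3 \<Rightarrow> 'a" and G :: "real \<Rightarrow> real"
  assumes "finite_measure \<mu>" and sets: "sets \<mu> = sets borel"
    and g: "linear g"
    and avg: "\<And>y w. norm y = 1 \<Longrightarrow> 0 \<le> w \<Longrightarrow>
      (\<integral>\<^sup>+v. ennreal (max \<bar>g y \<bullet> v\<bar> (w * \<bar>e \<bullet> v\<bar>)) \<partial>\<mu>) = ennreal (G w)"
    and G0: "\<And>w. 0 \<le> w \<Longrightarrow> 0 \<le> G w" and w: "0 \<le> w"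
  shows "G (2 * w) + 3 * G 0 \<le> 4 * G w"
proof -
  interpret \<mu>: finite_measure \<mu> by fact
  interpret pair_sigma_finite \<mu> "lborel :: (real ^ 3) measure" ..
  note [measurable_cong] = sets
  have [measurable]: "(cball 0 1 :: (real ^ 3) set) \<in> sets borel" by simp
  have [measurable]: "g \<in> borel_measurable borel"
    using g by (intro borel_measurable_continuous_onI linear_continuous_on)
      (simp add: linear_conv_bounded_linear)
  define I where "I w v = (\<integral>\<^sup>+y\<in>cball 0 1. ennreal (max (\<bar>g y \<bullet> v\<bar> / norm y) (w * \<bar>e \<bullet> v\<bar>)) \<partial>lborel)" for w v
  have [measurable]: "I w \<in> borel_measurable \<mu>" for w
    unfolding I_def by measurable
  have I: "(\<integral>\<^sup>+v. I w v \<partial>\<mu>) = ennreal (4 * pi / 3 * G w)" if "0 \<le> w" for w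
  proof -
    have "(\<integral>\<^sup>+v. I w v \<partial>\<mu>) = (\<integral>\<^sup>+y. \<integral>\<^sup>+v.
        ennreal (max (\<bar>g y \<bullet> v\<bar> / norm y) (w * \<bar>e \<bullet> v\<bar>)) * indicator (cball 0 1) y \<partial>\<mu> \<partial>lborel)"
      unfolding I_def by (rule Fubini'[symmetric]) measurable
    also have "\<dots> = (\<integral>\<^sup>+y. ennreal (G w) * indicator (cball 0 1) y \<partial>(lborel :: (real ^ 3) measure))"
    proof (rule nn_integral_cong_AE)
      \<comment> \<open>Only at the origin does \<open>sgn y\<close> fail to be a unit vector, and
        there \<open>avg\<close> says nothing.\<close>
      have "AE y in (lborel :: (real ^ 3) measure). y \<noteq> 0"
        by (rule AE_lborel_singleton)
      then show "AE y in lborel. (\<integral>\<^sup>+v.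
        ennreal (max (\<bar>g y \<bullet> v\<bar> / norm y) (w * \<bar>e \<bullet> v\<bar>)) * indicator (cball 0 1) y \<partial>\<mu>) =
        ennreal (G w) * indicator (cball 0 1) y"
      proof eventually_elim
        case (elim y)
        have "\<bar>g (sgn y) \<bullet> v\<bar> = \<bar>g y \<bullet> v\<bar> / norm y" for v
          using g by (simp add: sgn_div_norm linear_scale abs_mult divide_inverse mult.commute)
        then have "(\<integral>\<^sup>+v. ennreal (max (\<bar>g y \<bullet> v\<bar> / norm y) (w * \<bar>e \<bullet> v\<bar>)) \<partial>\<mu>) = ennreal (G w)"
          using avg[of "sgn y" w] that elim by (simp add: norm_sgn)
        then show ?case by (subst nn_integral_multc) auto
      qed
    qed
    also have "\<dots> = ennreal (G w) * ennreal (4 * pi / 3)"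
      by (subst nn_integral_cmult_indicator) (simp_all add: emeasure_cball unit_ball_vol_3)
    also have "\<dots> = ennreal (4 * pi / 3 * G w)"
      by (subst mult.commute, rule ennreal_mult'[symmetric]) simp
    finally show ?thesis .
  qed
  have le: "I (2 * w) v + 3 * I 0 v \<le> 4 * I w v" for v
  proof -
    \<comment> \<open>The adjoint makes \<open>g y \<bullet> v\<close> an inner product in
      \<open>real ^ 3\<close>, so that \<open>v\<close> enters only through the vector
      \<open>adjoint g v\<close> and the number \<open>\<bar>e \<bullet> v\<bar>\<close>.\<close>
    have "I w v = (\<integral>\<^sup>+y\<in>cball 0 1. ennreal (max (\<bar>adjoint g v \<bullet> y\<bar> / norm y) (w * \<bar>e \<bullet> v\<bar>)) \<partial>lborel)" for w
      by (simp add: I_def adjoint_clauses[OF g] inner_commute[of v])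
    then show ?thesis
      using nn_integral_cball_max_double[of "w * \<bar>e \<bullet> v\<bar>" "adjoint g v"] w by (simp add: mult.assoc)
  qed
  have "(\<integral>\<^sup>+v. I (2 * w) v + 3 * I 0 v \<partial>\<mu>) \<le> (\<integral>\<^sup>+v. 4 * I w v \<partial>\<mu>)"
    by (intro nn_integral_mono le)
  then have "ennreal (4 * pi / 3 * G (2 * w)) + 3 * ennreal (4 * pi / 3 * G 0) \<le> 4 * ennreal (4 * pi / 3 * G w)"
    using w by (simp add: nn_integral_add nn_integral_cmult I)
  moreover have "ennreal x + 3 * ennreal y = ennreal (x + 3 * y)" if "0 \<le> x" "0 \<le> y" for x y
    using that by (simp add: ennreal_mult')
  moreover have "4 * ennreal x = ennreal (4 * x)" for x
    by (simp add: ennreal_mult')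
  ultimately have "ennreal (4 * pi / 3 * G (2 * w) + 3 * (4 * pi / 3 * G 0)) \<le> ennreal (4 * (4 * pi / 3 * G w))"
    using w G0[of 0] G0[of "2 * w"] by simp
  then have "4 * pi / 3 * G (2 * w) + 3 * (4 * pi / 3 * G 0) \<le> 4 * (4 * pi / 3 * G w)"
    by (rule ennreal_le_iff[THEN iffD1, rotated]) (use w G0[of w] in simp)
  then have "4 * pi / 3 * (G (2 * w) + 3 * G 0) \<le> 4 * pi / 3 * (4 * G w)"
    by (simp add: distrib_left)
  then show ?thesis by (rule mult_left_le_imp_le) simp
qed

subsection \<open>The fourth order expansion\<close>

text \<open>A second derivative of the integral is available only at the endpoint, so l'Hospital's
  rule is applied once, and what remains is the difference quotient of \<open>\<phi>\<close> at
  \<open>1\<close>. The sign of \<open>D / 2\<close> comes from expanding in \<open>1 - w\<close>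
  instead of \<open>w - 1\<close>.\<close>

lemma integral_taylor_at_left:
  fixes \<phi> :: "real \<Rightarrow> real"
  assumes d: "0 < d" "d \<le> 1" and int: "\<phi> integrable_on {0..1}"
    and cont: "continuous_on {1 - d..1} \<phi>"
    and deriv: "(\<phi> has_real_derivative D) (at_left 1)"
  shows "((\<lambda>w. (integral {0..1} \<phi> - integral {0..w} \<phi> - \<phi> 1 * (1 - w) + D / 2 * (1 - w)\<^sup>2) / (1 - w)\<^sup>2)
    \<longlongrightarrow> 0) (at_left 1)"
proof (rule lhopital_left)
  let ?F = "\<lambda>w. integral {0..w} \<phi>"
  have "continuous_on {0..1} ?F"
    by (rule indefinite_integral_continuous_1[OF int])
  then have "(?F \<longlongrightarrow> ?F 1) (at_left 1)"
    unfolding continuous_on_def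
    using at_within_Icc_at_left[of 0 "1 :: real"] by (metis atLeastAtMost_iff order_refl zero_le_one zero_less_one)
  then show "((\<lambda>w. integral {0..1} \<phi> - ?F w - \<phi> 1 * (1 - w) + D / 2 * (1 - w)\<^sup>2) \<longlongrightarrow> 0) (at_left 1)"
    by (auto intro!: tendsto_eq_intros)
  show "((\<lambda>w. (1 - w)\<^sup>2) \<longlongrightarrow> 0) (at_left (1 :: real))"
    by (auto intro!: tendsto_eq_intros)
  have near: "\<forall>\<^sub>F w in at_left 1. w \<in> {1 - d<..<1}"
    by (rule eventually_at_left_real) (use d in auto)
  show "\<forall>\<^sub>F w in at_left 1. (1 - w)\<^sup>2 \<noteq> (0 :: real)" "\<forall>\<^sub>F w in at_left 1. - 2 * (1 - w) \<noteq> (0 :: real)"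
    by (rule eventually_mono[OF near]; simp)+
  show "\<forall>\<^sub>F w in at_left 1. ((\<lambda>w. (1 - w)\<^sup>2) has_real_derivative - 2 * (1 - w)) (at w)"
    by (rule always_eventually) (auto intro!: derivative_eq_intros)
  show "\<forall>\<^sub>F w in at_left 1. ((\<lambda>w. integral {0..1} \<phi> - ?F w - \<phi> 1 * (1 - w) + D / 2 * (1 - w)\<^sup>2)
      has_real_derivative - \<phi> w + \<phi> 1 - D * (1 - w)) (at w)"
  proof (rule eventually_mono[OF near])
    fix w assume w: "w \<in> {1 - d<..<1}"
    have "((\<lambda>w. integral {1 - d..w} \<phi>) has_real_derivative \<phi> w) (at w within {1 - d..1})"
      by (rule integral_has_real_derivative[OF cont]) (use w in auto)
    then have "((\<lambda>w. integral {1 - d..w} \<phi>) has_real_derivative \<phi> w) (at w)"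
      using w by (simp add: at_within_Icc_at)
    \<comment> \<open>Continuity is known only on \<open>{1 - d..1}\<close>: the fundamental theorem
      is used there, and the fixed integral up to \<open>1 - d\<close> is added.\<close>
    then have "((\<lambda>w. ?F (1 - d) + integral {1 - d..w} \<phi>) has_real_derivative \<phi> w) (at w)"
      by (auto intro!: derivative_eq_intros)
    then have "(?F has_real_derivative \<phi> w) (at w)"
    proof (rule has_field_derivative_transform_within_open[where S = "{1 - d<..<1}"])
      fix x assume x: "x \<in> {1 - d<..<1}"
      have "\<phi> integrable_on {0..x}" by (rule integrable_subinterval_real[OF int]) (use x in auto)
      then show "?F (1 - d) + integral {1 - d..x} \<phi> = ?F x"
        using d x by (intro Henstock_Kurzweil_Integration.integral_combine) auto
    qed (use w in auto)
    then show "((\<lambda>w. integral {0..1} \<phi> - ?F w - \<phi> 1 * (1 - w) + D / 2 * (1 - w)\<^sup>2)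
      has_real_derivative - \<phi> w + \<phi> 1 - D * (1 - w)) (at w)"
      by (auto intro!: derivative_eq_intros simp: field_simps)
  qed
  have "((\<lambda>w. ((\<phi> w - \<phi> 1) / (w - 1) - D) / -2) \<longlongrightarrow> (D - D) / -2) (at_left 1)"
    using deriv unfolding has_field_derivative_iff by (intro tendsto_intros) auto
  moreover have "\<forall>\<^sub>F w in at_left 1. ((\<phi> w - \<phi> 1) / (w - 1) - D) / -2 = (- \<phi> w + \<phi> 1 - D * (1 - w)) / (- 2 * (1 - w))"
    by (rule eventually_mono[OF near]) (simp add: field_simps)
  ultimately show "((\<lambda>w. (- \<phi> w + \<phi> 1 - D * (1 - w)) / (- 2 * (1 - w))) \<longlongrightarrow> 0) (at_left 1)"
    by (simp add: tendsto_cong)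
qed

text \<open>The slope \<open>- 3 * \<phi> 1\<close> is that of a cube \<open>\<rho> ^ 3\<close> with
  \<open>\<rho>' = - \<rho>\<close> at \<open>1\<close>. It yields
  \<open>D z = A - B * z\<^sup>2 / 2\<close> up to \<open>o(z ^ 4)\<close>, so the reciprocal has
  the positive fourth coefficient \<open>B\<^sup>2 / (4 * A ^ 3)\<close>, while the combination
  \<open>f (2 * z) + 3 * f 0 - 4 * f z\<close> removes the constant and quadratic terms.\<close>

lemma reciprocal_integral_not_double:
  fixes \<phi> :: "real \<Rightarrow> real"
  assumes d: "0 < d" "d \<le> 1" and int: "\<phi> integrable_on {0..1}"
    and cont: "continuous_on {1 - d..1} \<phi>"
    and deriv: "(\<phi> has_real_derivative - 3 * \<phi> 1) (at_left 1)"
    and pos: "0 < \<phi> 1" "0 < integral {0..1} \<phi>"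
  defines "D \<equiv> \<lambda>z. integral {0..1 / sqrt (1 + z\<^sup>2)} \<phi>"
  shows "\<exists>z>0. 4 / D z < 1 / D (2 * z) + 3 / D 0"
proof -
  define B A where "B = \<phi> 1" and "A = integral {0..1} \<phi>"
  have BA: "0 < B" "0 < A" using pos by (simp_all add: A_def B_def)
  have D0: "D 0 = A" by (simp add: D_def A_def)
  define w :: "real \<Rightarrow> real" where "w z = 1 / sqrt (1 + z\<^sup>2)" for z
  define e where "e w = (A - integral {0..w} \<phi> - B * (1 - w) - 3 / 2 * B * (1 - w)\<^sup>2) / (1 - w)\<^sup>2" for w
  have "(e \<longlongrightarrow> 0) (at_left 1)"
    using integral_taylor_at_left[OF d int cont deriv] unfolding e_def A_def B_def by simp
  moreover have "filterlim w (at_left 1) (at_right 0)"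
    unfolding w_def by real_asymp
  ultimately have ew: "((\<lambda>z. e (w z)) \<longlongrightarrow> 0) (at_right 0)"
    by (rule filterlim_compose)
  have w1: "((\<lambda>z. (1 - w z)\<^sup>2 / z ^ 4) \<longlongrightarrow> 1 / 4) (at_right 0)"
    unfolding w_def by (real_asymp simp: power2_eq_square)
  \<comment> \<open>Here \<open>1 - w z\<close> is \<open>z\<^sup>2 / 2 - 3 * z ^ 4 / 8\<close> up
    to higher order and its square is \<open>z ^ 4 / 4\<close>, so the fourth order terms
    \<open>- 3 / 8 * B\<close> and \<open>3 / 2 * B / 4\<close> cancel.\<close>
  have w2: "((\<lambda>z. (B * (1 - w z) + 3 / 2 * B * (1 - w z)\<^sup>2 - B * z\<^sup>2 / 2) / z ^ 4) \<longlongrightarrow> 0) (at_right 0)"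
    unfolding w_def using BA by (real_asymp simp: power2_eq_square)
  have "((\<lambda>z. e (w z) * ((1 - w z)\<^sup>2 / z ^ 4) +
      (B * (1 - w z) + 3 / 2 * B * (1 - w z)\<^sup>2 - B * z\<^sup>2 / 2) / z ^ 4) \<longlongrightarrow> 0 * (1 / 4) + 0) (at_right 0)"
    by (rule tendsto_add[OF tendsto_mult[OF ew w1] w2])
  moreover have pos0: "\<forall>\<^sub>F z in at_right (0 :: real). 0 < z"
    by (simp add: eventually_at_filter)
  then have "\<forall>\<^sub>F z in at_right 0. e (w z) * ((1 - w z)\<^sup>2 / z ^ 4) +
      (B * (1 - w z) + 3 / 2 * B * (1 - w z)\<^sup>2 - B * z\<^sup>2 / 2) / z ^ 4 = (A - D z - B * z\<^sup>2 / 2) / z ^ 4"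
  proof eventually_elim
    case (elim z)
    then have "1 < sqrt (1 + z\<^sup>2)" by simp
    then have "w z < 1" unfolding w_def by (subst divide_less_eq_1_pos) (auto simp: add_pos_nonneg)
    then have "(1 - w z)\<^sup>2 \<noteq> 0" by simp
    then have "e (w z) * (1 - w z)\<^sup>2 = A - D z - B * (1 - w z) - 3 / 2 * B * (1 - w z)\<^sup>2"
      unfolding e_def D_def w_def by simp
    then have eq: "e (w z) * ((1 - w z)\<^sup>2 / z ^ 4) = (A - D z - B * (1 - w z) - 3 / 2 * B * (1 - w z)\<^sup>2) / z ^ 4"
      by (metis times_divide_eq_right)
    show ?case unfolding eq add_divide_distrib[symmetric] by simp
  qed
  ultimately have lim4: "((\<lambda>z. (A - D z - B * z\<^sup>2 / 2) / z ^ 4) \<longlongrightarrow> 0) (at_right 0)"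
    by (simp add: tendsto_cong)
  have "((\<lambda>z. (A - D z - B * z\<^sup>2 / 2) / z ^ 4 * z\<^sup>2 + B / 2) \<longlongrightarrow> 0 * 0\<^sup>2 + B / 2) (at_right 0)"
    by (rule tendsto_add[OF tendsto_mult[OF lim4 tendsto_power[OF tendsto_ident_at]] tendsto_const])
  moreover have "\<forall>\<^sub>F z in at_right 0. (A - D z - B * z\<^sup>2 / 2) / z ^ 4 * z\<^sup>2 + B / 2 = (A - D z) / z\<^sup>2"
    using pos0 by eventually_elim (simp add: field_simps power2_eq_square power4_eq_xxxx)
  ultimately have lim2: "((\<lambda>z. (A - D z) / z\<^sup>2) \<longlongrightarrow> B / 2) (at_right 0)"
    by (simp add: tendsto_cong)
  have "((\<lambda>z. A - (A - D z) / z\<^sup>2 * z\<^sup>2) \<longlongrightarrow> A - B / 2 * 0\<^sup>2) (at_right 0)"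
    by (intro tendsto_intros lim2)
  moreover have "\<forall>\<^sub>F z in at_right 0. A - (A - D z) / z\<^sup>2 * z\<^sup>2 = D z"
    using pos0 by eventually_elim simp
  ultimately have limD: "(D \<longlongrightarrow> A) (at_right 0)"
    by (simp add: tendsto_cong)
  then have Dpos: "\<forall>\<^sub>F z in at_right 0. 0 < D z"
    using BA order_tendstoD(1) by blast
  define E where "E z = (1 / D z - 1 / A - B * z\<^sup>2 / (2 * A\<^sup>2)) / z ^ 4" for z
  \<comment> \<open>This rests on the exact identity \<open>1 / D - 1 / A = (A - D) / A\<^sup>2 + (A
    - D)\<^sup>2 / (A\<^sup>2 * D)\<close>.\<close>
  have "((\<lambda>z. (A - D z - B * z\<^sup>2 / 2) / z ^ 4 / A\<^sup>2 + ((A - D z) / z\<^sup>2)\<^sup>2 / (A\<^sup>2 * D z))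
      \<longlongrightarrow> 0 / A\<^sup>2 + (B / 2)\<^sup>2 / (A\<^sup>2 * A)) (at_right 0)"
    using BA by (intro tendsto_intros lim2 lim4 limD) auto
  moreover have "\<forall>\<^sub>F z in at_right 0.
      (A - D z - B * z\<^sup>2 / 2) / z ^ 4 / A\<^sup>2 + ((A - D z) / z\<^sup>2)\<^sup>2 / (A\<^sup>2 * D z) = E z"
    using pos0 Dpos by eventually_elim
      (use BA in \<open>simp add: E_def field_simps power2_eq_square power4_eq_xxxx\<close>)
  ultimately have limE: "(E \<longlongrightarrow> (B / 2)\<^sup>2 / A ^ 3) (at_right 0)"
    by (simp add: tendsto_cong power3_eq_cube power2_eq_square)
  have "filterlim (\<lambda>z :: real. 2 * z) (at_right 0) (at_right 0)" by real_asymp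
  \<comment> \<open>The weight \<open>16\<close> is \<open>2 ^ 4\<close>, from the denominator of
    \<open>E (2 * z)\<close>; with weights \<open>16\<close> and \<open>- 4\<close> the quadratic
    terms subtracted in \<open>E\<close> cancel.\<close>
  from filterlim_compose[OF limE this]
  have "((\<lambda>z. 16 * E (2 * z) - 4 * E z) \<longlongrightarrow> 16 * ((B / 2)\<^sup>2 / A ^ 3) - 4 * ((B / 2)\<^sup>2 / A ^ 3)) (at_right 0)"
    by (intro tendsto_intros limE)
  moreover have "0 < 16 * ((B / 2)\<^sup>2 / A ^ 3) - 4 * ((B / 2)\<^sup>2 / A ^ 3)"
    using BA by simp
  ultimately have "\<forall>\<^sub>F z in at_right 0. 0 < 16 * E (2 * z) - 4 * E z"
    using order_tendstoD(1) by blast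
  with pos0 have "\<forall>\<^sub>F z in at_right 0. 0 < z \<and> 0 < 16 * E (2 * z) - 4 * E z"
    by eventually_elim simp
  then obtain z where z: "0 < z" "0 < 16 * E (2 * z) - 4 * E z"
    using eventually_happens trivial_limit_at_right_real by blast
  have "16 * E (2 * z) - 4 * E z = (1 / D (2 * z) + 3 / A - 4 / D z) / z ^ 4"
    using z(1) by (simp add: E_def power_mult_distrib divide_simps) (simp add: algebra_simps)
  with z have "4 / D z < 1 / D (2 * z) + 3 / D 0"
    by (simp add: D0 zero_less_divide_iff)
  with z(1) show ?thesis by blast
qed

subsection \<open>Sections of symmetric bodies of revolution\<close>

text \<open>If \<open>x\<close> is the centre of a ball in \<open>K\<close>, each small
  \<open>v\<close> is the midpoint of \<open>x + v\<close> and \<open>- (x - v)\<close>, both in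
  \<open>K\<close>.\<close>

lemma origin_symmetric_ball:
  fixes K :: "'a :: euclidean_space set"
  assumes "convex K" "interior K \<noteq> {}" "origin_symmetric K"
  obtains r where "0 < r" "cball 0 r \<subseteq> K"
proof -
  obtain x e where e: "0 < e" "cball x e \<subseteq> K"
    using assms(2) by (metis all_not_in_conv mem_interior_cball)
  have "cball 0 e \<subseteq> K"
  proof
    fix v :: 'a assume "v \<in> cball 0 e"
    then have "x + v \<in> K" "x - v \<in> K" using e(2) by (auto simp: dist_norm subset_iff)
    then have "- (x - v) \<in> K" using assms(3) unfolding origin_symmetric_def by blast
    with \<open>x + v \<in> K\<close> have "(1 / 2) *\<^sub>R (x + v) + (1 / 2) *\<^sub>R - (x - v) \<in> K"
      using assms(1) by (intro convexD) auto
    moreover have "(1 / 2) *\<^sub>R (x + v) + (1 / 2) *\<^sub>R - (x - v) = v"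
      by (simp add: algebra_simps flip: scaleR_2 scaleR_left_distrib)
    ultimately show "v \<in> K" by simp
  qed
  with e(1) show ?thesis by (rule that)
qed

lemma scaleR_mem_iff_radial_function:
  fixes K :: "'a :: euclidean_space set"
  assumes "compact K" "convex K" "0 \<in> K" "u \<noteq> 0" "0 \<le> r"
  shows "r *\<^sub>R u \<in> K \<longleftrightarrow> r \<le> radial_function K u"
proof -
  let ?S = "{r. 0 \<le> r \<and> r *\<^sub>R u \<in> K}"
  obtain B where B: "\<And>x. x \<in> K \<Longrightarrow> norm x \<le> B"
    using compact_imp_bounded[OF assms(1)] bounded_iff by blast
  have bdd: "bdd_above ?S"
  proof (rule bdd_aboveI)
    fix r assume "r \<in> ?S"
    then show "r \<le> B / norm u" using B[of "r *\<^sub>R u"] assms(4) by (simp add: field_simps)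
  qed
  have "closed ((\<lambda>r. r *\<^sub>R u) -` K)"
    using assms(1) by (intro continuous_closed_vimage compact_imp_closed) (auto intro: continuous_intros)
  then have "closed ({0..} \<inter> (\<lambda>r. r *\<^sub>R u) -` K)" by (intro closed_Int) auto
  moreover have "{0..} \<inter> (\<lambda>r. r *\<^sub>R u) -` K = ?S" by auto
  ultimately have "Sup ?S \<in> ?S"
    using assms(3) bdd by (intro closed_contains_Sup) auto
  then have sup: "0 \<le> radial_function K u" "radial_function K u *\<^sub>R u \<in> K"
    unfolding radial_function_def by auto
  show ?thesis
  proof
    assume "r *\<^sub>R u \<in> K"
    then show "r \<le> radial_function K u"
      unfolding radial_function_def using bdd assms(5) by (intro cSup_upper) auto
  next
    assume le: "r \<le> radial_function K u"
    show "r *\<^sub>R u \<in> K"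
    proof (cases "radial_function K u = 0")
      case True
      with le assms show ?thesis by simp
    next
      case False
      define s where "s = r / radial_function K u"
      have s: "0 \<le> s" "s \<le> 1" using le sup(1) False assms(5) by (auto simp: s_def)
      have "s *\<^sub>R (radial_function K u *\<^sub>R u) + (1 - s) *\<^sub>R 0 \<in> K"
        using assms(2,3) sup(2) s by (intro convexD) auto
      then show ?thesis using False by (simp add: s_def)
    qed
  qed
qed

text \<open>Boundedness of the polar body is what makes the support function positive: otherwise the
  whole ray through \<open>\<xi>\<close> would lie in the polar body.\<close>

lemma support_function_eq_inverse_radial_function:
  fixes Z :: "'a :: euclidean_space set"
  assumes "Z \<noteq> {}" "compact Z" "bounded (polar_body Z)" "norm \<xi> = 1"
  shows "support_function Z \<xi> = 1 / radial_function (polar_body Z) \<xi>"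
proof -
  let ?h = "support_function Z \<xi>"
  have "bounded ((\<bullet>) \<xi> ` Z)"
    using assms(2) by (intro compact_imp_bounded compact_continuous_image continuous_intros)
  then have bdd: "bdd_above ((\<bullet>) \<xi> ` Z)" by (rule bounded_imp_bdd_above)
  have mem: "r *\<^sub>R \<xi> \<in> polar_body Z \<longleftrightarrow> r * ?h \<le> 1" if "0 \<le> r" for r
  proof (cases "r = 0")
    case False
    with that have "r *\<^sub>R \<xi> \<in> polar_body Z \<longleftrightarrow> (\<forall>y\<in>Z. \<xi> \<bullet> y \<le> 1 / r)"
      by (simp add: polar_body_def field_simps)
    also have "\<dots> \<longleftrightarrow> ?h \<le> 1 / r"
      unfolding support_function_def using assms(1) bdd by (simp add: cSUP_le_iff)
    finally show ?thesis using False that by (simp add: field_simps)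
  qed (simp add: polar_body_def)
  have pos: "0 < ?h"
  proof (rule ccontr)
    assume "\<not> 0 < ?h"
    then have all: "r *\<^sub>R \<xi> \<in> polar_body Z" if "0 \<le> r" for r
      using mem[OF that] that by (smt (verit) mult_nonneg_nonpos)
    obtain B where B: "0 < B" "\<And>x. x \<in> polar_body Z \<Longrightarrow> norm x \<le> B"
      using assms(3) bounded_pos by blast
    then show False using B(2)[OF all[of "B + 1"]] assms(4) by simp
  qed
  have "{r. 0 \<le> r \<and> r *\<^sub>R \<xi> \<in> polar_body Z} = {0..1 / ?h}"
    using mem pos by (auto simp: field_simps)
  then have "radial_function (polar_body Z) \<xi> = 1 / ?h"
    unfolding radial_function_def using pos by simp
  then show ?thesis by simp
qed

lemma norm_revolution_direction:
  assumes "\<bar>t\<bar> \<le> 1"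
  shows "norm (sqrt (1 - t\<^sup>2) *\<^sub>R axis 1 1 + t *\<^sub>R axis 4 1 :: real ^ 4) = 1"
  unfolding norm_eq_1 using abs_square_le_1[of t] assms
  by (simp add: inner_add_left inner_add_right inner_axis_axis power2_eq_square[symmetric])

text \<open>Valid also for \<open>\<bar>t\<bar> > 1\<close>, where the vector need not have norm
  \<open>1\<close>. Thus the membership criterion for \<open>revolution_radial\<close> holds on the
  whole line, with no domain to track.\<close>

lemma revolution_direction_nonzero: "sqrt (1 - t\<^sup>2) *\<^sub>R axis 1 1 + t *\<^sub>R axis 4 1 \<noteq> (0 :: real ^ 4)"
proof
  assume eq: "sqrt (1 - t\<^sup>2) *\<^sub>R axis 1 1 + t *\<^sub>R axis 4 1 = (0 :: real ^ 4)"
  then have "(sqrt (1 - t\<^sup>2) *\<^sub>R axis 1 1 + t *\<^sub>R axis 4 1 :: real ^ 4) $ 4 = 0" by simp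
  then have "t = 0" by (simp add: axis_def)
  with norm_revolution_direction[of t] eq show False by simp
qed

section \<open>A fixed symmetric body of revolution and its central sections\<close>

locale symmetric_body_of_revolution =
  fixes K :: "(real ^ 4) set"
  assumes body: "convex_body K" and sym: "origin_symmetric K" and rev: "body_of_revolution K"
begin

abbreviation \<rho> where "\<rho> \<equiv> revolution_radial K"

lemma compact: "compact K" and convex: "convex K" and interior: "interior K \<noteq> {}"
  using body by (simp_all add: convex_body_def)

lemma zero_mem: "0 \<in> K"
  by (rule origin_symmetric_ball[OF convex interior sym]) (auto simp: subset_iff)

lemma le_revolution_radial_iff:
  "0 \<le> r \<Longrightarrow> r \<le> \<rho> t \<longleftrightarrow> r *\<^sub>R (sqrt (1 - t\<^sup>2) *\<^sub>R axis 1 1 + t *\<^sub>R axis 4 1) \<in> K"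
  unfolding revolution_radial_def
  by (rule scaleR_mem_iff_radial_function[symmetric, OF compact convex zero_mem revolution_direction_nonzero])

lemma revolution_radial_nonneg: "0 \<le> \<rho> t"
  by (simp add: le_revolution_radial_iff zero_mem)

text \<open>The function is upper semicontinuous for nonnegative levels: such a superlevel set is
  the preimage of the compact \<open>K\<close> under a continuous curve.\<close>

lemma borel_measurable_revolution_radial [measurable]: "\<rho> \<in> borel_measurable borel"
  unfolding borel_measurable_iff_ge
proof
  fix a :: real
  show "{t \<in> space borel. a \<le> \<rho> t} \<in> sets borel"
  proof (cases "0 \<le> a")
    case True
    have "closed ((\<lambda>t. a *\<^sub>R (sqrt (1 - t\<^sup>2) *\<^sub>R axis 1 1 + t *\<^sub>R axis 4 1)) -` K)"
      using compact by (intro continuous_closed_vimage compact_imp_closed) (auto intro!: continuous_intros)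
    moreover have "\<dots> = {t \<in> space borel. a \<le> \<rho> t}"
      using True by (auto simp: le_revolution_radial_iff)
    ultimately show ?thesis by (simp add: borel_closed)
  next
    case False
    then have "a \<le> \<rho> t" for t
      using revolution_radial_nonneg[of t] by linarith
    then have "{t \<in> space borel. a \<le> \<rho> t} = UNIV" by simp
    then show ?thesis by simp
  qed
qed

lemma revolution_radial_bounds:
  obtains r R where "0 < r" "\<And>t. \<bar>t\<bar> \<le> 1 \<Longrightarrow> r \<le> \<rho> t" "\<And>t. \<bar>t\<bar> \<le> 1 \<Longrightarrow> \<rho> t \<le> R"
proof -
  obtain r where r: "0 < r" "cball 0 r \<subseteq> K"
    by (rule origin_symmetric_ball[OF convex interior sym])
  obtain R where R: "\<And>x. x \<in> K \<Longrightarrow> norm x \<le> R"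
    using compact_imp_bounded[OF compact] bounded_iff by blast
  show ?thesis
  proof (rule that)
    show "r \<le> \<rho> t" if "\<bar>t\<bar> \<le> 1" for t
      using r that by (subst le_revolution_radial_iff) (auto simp: norm_revolution_direction subset_iff)
    show "\<rho> t \<le> R" if "\<bar>t\<bar> \<le> 1" for t
    proof -
      have "\<rho> t *\<^sub>R (sqrt (1 - t\<^sup>2) *\<^sub>R axis 1 1 + t *\<^sub>R axis 4 1) \<in> K"
        using le_revolution_radial_iff[OF revolution_radial_nonneg] by blast
      from R[OF this] show ?thesis
        using revolution_radial_nonneg[of t] by (simp add: norm_revolution_direction that)
    qed
  qed (rule r)
qed

lemma revolution_radial_pos: "\<bar>t\<bar> \<le> 1 \<Longrightarrow> 0 < \<rho> t"
  by (rule revolution_radial_bounds) (meson less_le_trans)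

text \<open>A rotation about the axis carries \<open>x\<close> into the meridian half-plane used by
  \<open>revolution_radial\<close>, and the symmetry \<open>x \<mapsto> - x\<close> permits the
  absolute value. At the origin \<open>0 / 0 = 0\<close> is harmless.\<close>

lemma mem_iff: "x \<in> K \<longleftrightarrow> norm x \<le> \<rho> (\<bar>x $ 4\<bar> / norm x)"
proof -
  have pos: "x \<in> K \<longleftrightarrow> norm x \<le> \<rho> (x $ 4 / norm x)" if "x \<noteq> 0" for x
  proof -
    define t where "t = x $ 4 / norm x"
    define p where "p = sgn x - t *\<^sub>R axis 4 1"
    have t: "sgn x $ 4 = t" by (simp add: sgn_div_norm t_def divide_inverse mult.commute)
    have t1: "\<bar>t\<bar> \<le> 1" using component_le_norm_cart[of "sgn x" 4] that by (simp add: t norm_sgn)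
    have p4: "p $ 4 = 0" by (simp add: p_def t axis_def)
    have "(norm (sgn x))\<^sup>2 = (norm p)\<^sup>2 + t\<^sup>2"
    proof -
      have "p \<bullet> (t *\<^sub>R axis 4 1) = 0" using p4 by (simp add: inner_axis)
      then have "(norm (p + t *\<^sub>R axis 4 1))\<^sup>2 = (norm p)\<^sup>2 + (norm (t *\<^sub>R axis 4 1 :: real ^ 4))\<^sup>2"
        by (simp add: norm_add_Pythagorean orthogonal_def)
      then show ?thesis by (simp add: p_def norm_axis_1 power2_eq_square)
    qed
    then have np: "norm p = sqrt (1 - t\<^sup>2)"
      using that by (intro real_sqrt_unique[symmetric]) (auto simp: norm_sgn)
    \<comment> \<open>On the axis \<open>p = 0\<close>, and any equatorial direction serves because
      its coefficient vanishes.\<close>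
    define \<xi> where "\<xi> = (if p = 0 then axis 1 1 else sgn p)"
    have \<xi>: "norm \<xi> = 1" by (simp add: \<xi>_def norm_axis_1 norm_sgn)
    have \<xi>4: "\<xi> $ 4 = 0" using p4 by (simp add: \<xi>_def axis_def sgn_div_norm)
    have "sqrt (1 - t\<^sup>2) *\<^sub>R \<xi> = p"
      unfolding np[symmetric] by (simp add: \<xi>_def sgn_div_norm)
    then have "sgn x = sqrt (1 - t\<^sup>2) *\<^sub>R \<xi> + t *\<^sub>R axis 4 1" by (simp add: p_def)
    then have "radial_function K (sgn x) = \<rho> t"
      using revolution_radial_eq[OF rev \<xi> \<xi>4] by simp
    moreover have "x = norm x *\<^sub>R sgn x" using that by (simp add: sgn_div_norm)
    ultimately show ?thesis
      using scaleR_mem_iff_radial_function[OF compact convex zero_mem, of "sgn x" "norm x"] that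
      by (simp add: t_def sgn_zero_iff)
  qed
  consider "x = 0" | "x \<noteq> 0" "0 \<le> x $ 4" | "x \<noteq> 0" "x $ 4 \<le> 0" by linarith
  then show ?thesis
  proof cases
    case 1
    then show ?thesis by (simp add: zero_mem revolution_radial_nonneg)
  next
    case 2
    then show ?thesis using pos by simp
  next
    case 3
    have "x \<in> K \<longleftrightarrow> - x \<in> K"
      using sym unfolding origin_symmetric_def by (metis add.inverse_inverse image_eqI)
    then show ?thesis using pos[of "- x"] 3 by simp
  qed
qed

lemma set_integrable_revolution_radial_cubed:
  "0 \<le> l \<Longrightarrow> l \<le> 1 \<Longrightarrow> set_integrable lborel {0..l} (\<lambda>t. \<rho> t ^ 3)"
proof (rule revolution_radial_bounds)
  fix r R assume l: "0 \<le> l" "l \<le> 1" and R: "\<And>t. \<bar>t\<bar> \<le> 1 \<Longrightarrow> \<rho> t \<le> R"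
  show "set_integrable lborel {0..l} (\<lambda>t. \<rho> t ^ 3)"
    unfolding set_integrable_def
    by (rule integrableI_bounded_set_indicator[where B = "R ^ 3"])
       (use l R in \<open>auto intro!: AE_I2 power_mono simp: revolution_radial_nonneg\<close>)
qed

lemma integral_revolution_radial_cubed_pos:
  assumes "0 < l" "l \<le> 1"
  shows "0 < integral {0..l} (\<lambda>t. \<rho> t ^ 3)"
proof (rule revolution_radial_bounds)
  fix r assume r: "0 < r" "\<And>t. \<bar>t\<bar> \<le> 1 \<Longrightarrow> r \<le> \<rho> t"
  have "0 < l * r ^ 3" using assms r by simp
  also have "\<dots> = integral {0..l} (\<lambda>t. r ^ 3)" using assms by simp
  also have "\<dots> \<le> integral {0..l} (\<lambda>t. \<rho> t ^ 3)"
    using assms r set_borel_integral_eq_integral(1)[OF set_integrable_revolution_radial_cubed[of l]]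
    by (intro integral_le) (auto intro!: power_mono)
  finally show ?thesis .
qed

text \<open>In coordinates of the hyperplane the height becomes a linear functional
  \<open>p \<bullet> y\<close> with \<open>norm p = l\<close>. The section is thus a radial graph
  over the latitude relative to \<open>q = p / l\<close>, and substituting \<open>t = l * c\<close>
  produces the integral.\<close>

lemma hyperplane_volume_section:
  assumes "norm \<xi> = 1" "1 - (\<xi> $ 4)\<^sup>2 = l\<^sup>2" "0 < l"
  shows "hyperplane_volume \<xi> (K \<inter> {x. \<xi> \<bullet> x = 0}) =
    4 * pi / (3 * l) * integral {0..l} (\<lambda>t. \<rho> t ^ 3)"
proof -
  define f where "f = (SOME f. hyperplane_isometry \<xi> f)"
  have f: "hyperplane_isometry \<xi> f"
    unfolding f_def by (rule hyperplane_isometry_some) (use assms in auto)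
  then have lin: "linear f" and nf: "\<And>y. norm (f y) = norm y" and ran: "range f = {x. \<xi> \<bullet> x = 0}"
    unfolding hyperplane_isometry_def by auto
  have inner: "f y \<bullet> f z = y \<bullet> z" for y z
    unfolding dot_norm by (simp add: nf linear_add[OF lin, symmetric])
  \<comment> \<open>This vector is the orthogonal projection of the axis direction to the
    hyperplane; its preimage \<open>p\<close> represents the height.\<close>
  have "axis 4 1 - (\<xi> $ 4) *\<^sub>R \<xi> \<in> range f"
    unfolding ran using assms(1) by (simp add: inner_diff_right inner_axis norm_eq_1)
  then obtain p where p: "axis 4 1 - (\<xi> $ 4) *\<^sub>R \<xi> = f p" by auto
  have f4: "f y $ 4 = p \<bullet> y" for y
  proof -
    have "\<xi> \<bullet> f y = 0" using ran by blast
    then have "f y $ 4 = f p \<bullet> f y"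
      unfolding p[symmetric] by (simp add: inner_diff_left inner_axis')
    then show ?thesis by (simp add: inner)
  qed
  have "(norm p)\<^sup>2 = l\<^sup>2"
  proof -
    have "(norm p)\<^sup>2 = (axis 4 1 - (\<xi> $ 4) *\<^sub>R \<xi>) \<bullet> (axis 4 1 - (\<xi> $ 4) *\<^sub>R \<xi>)"
      unfolding p using nf[of p] by (simp add: power2_norm_eq_inner[symmetric])
    also have "\<dots> = l\<^sup>2"
      using assms(1,2)
      by (simp add: inner_diff_left inner_diff_right inner_axis inner_axis' norm_eq_1 power2_eq_square)
    finally show ?thesis .
  qed
  then have np: "norm p = l" using assms(3) by (simp add: power2_eq_iff_nonneg)
  define q where "q = p /\<^sub>R l"
  have q: "norm q = 1" "p = l *\<^sub>R q" using assms(3) np by (simp_all add: q_def)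
  have "l\<^sup>2 \<le> 1\<^sup>2" unfolding assms(2)[symmetric] by simp
  then have l1: "l \<le> 1" by (rule power2_le_imp_le) simp
  have "f -` (K \<inter> {x. \<xi> \<bullet> x = 0}) = {y. norm y \<le> \<rho> (l * (\<bar>q \<bullet> y\<bar> / norm y))}" (is "?S = ?T")
    using ran assms(3) by (auto simp: mem_iff nf f4 q(2) abs_mult)
  then have "hyperplane_volume \<xi> (K \<inter> {x. \<xi> \<bullet> x = 0}) = measure lebesgue ?T"
    unfolding hyperplane_volume_def f_def by simp
  also have "\<dots> = measure lborel ?T"
    by (rule measure_completion) measurable
  finally have hv: "hyperplane_volume \<xi> (K \<inter> {x. \<xi> \<bullet> x = 0}) = enn2real (emeasure lborel ?T)"
    by (simp add: measure_def)
  let ?I = "integral {0..l} (\<lambda>t. \<rho> t ^ 3)"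
  have int: "set_integrable lborel {0..l} (\<lambda>t. \<rho> t ^ 3)"
    using assms(3) l1 by (intro set_integrable_revolution_radial_cubed) auto
  \<comment> \<open>The factor \<open>l\<close> is the Jacobian of \<open>t = l * c\<close>, kept on
    the left so that no division in \<open>ennreal\<close> occurs.\<close>
  have "ennreal l * emeasure lborel ?T =
      ennreal l * (\<integral>\<^sup>+c\<in>{0..1}. ennreal (4 * pi / 3 * \<rho> (l * c) ^ 3) \<partial>lborel)"
    by (subst emeasure_lborel_radial_graph[OF q(1), where g = "\<lambda>c. \<rho> (l * c)"])
       (auto simp: revolution_radial_nonneg)
  also have "\<dots> = (\<integral>\<^sup>+t\<in>{0..l}. ennreal (4 * pi / 3 * \<rho> t ^ 3) \<partial>lborel)"
    using assms(3) by (subst nn_integral_real_affine[where c = l and t = 0])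
      (auto intro!: arg_cong2[of _ _ _ _ "(*)"] nn_integral_cong simp: indicator_def zero_le_mult_iff)
  also have "\<dots> = (\<integral>\<^sup>+t. ennreal (4 * pi / 3 * (indicator {0..l} t *\<^sub>R \<rho> t ^ 3)) \<partial>lborel)"
    by (intro nn_integral_cong) (auto simp: indicator_def)
  also have "\<dots> = ennreal (LINT t|lborel. 4 * pi / 3 * (indicator {0..l} t *\<^sub>R \<rho> t ^ 3))"
    using int unfolding set_integrable_def
    by (intro nn_integral_eq_integral integrable_mult_right) (auto simp: revolution_radial_nonneg)
  also have "(LINT t|lborel. 4 * pi / 3 * (indicator {0..l} t *\<^sub>R \<rho> t ^ 3)) = 4 * pi / 3 * ?I"
    using set_borel_integral_eq_integral(2)[OF int] unfolding set_lebesgue_integral_def by simp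
  finally have "enn2real (ennreal l * emeasure lborel ?T) = 4 * pi / 3 * ?I"
    using integral_revolution_radial_cubed_pos[of l] assms(3) l1 by (simp add: less_imp_le)
  then show ?thesis
    using assms(3) by (simp add: hv enn2real_mult field_simps)
qed

text \<open>Polarity makes \<open>G z\<close> the cosine transform of \<open>\<mu>\<close> at every
  point of height \<open>z\<close> and distance \<open>1\<close> from the axis, and
  \<open>G z\<close> differs from \<open>1 / D z\<close> only by the factor
  \<open>3 / (4 * pi)\<close>. So the averaged inequality passes to \<open>1 / D\<close>.\<close>

lemma reciprocal_integral_double_if_polar_zonoid:
  assumes "polar_zonoid (intersection_body K)" and "0 \<le> w"
  defines "D \<equiv> \<lambda>z. integral {0..1 / sqrt (1 + z\<^sup>2)} (\<lambda>t. \<rho> t ^ 3)"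
  shows "1 / D (2 * w) + 3 / D 0 \<le> 4 / D w"
proof -
  obtain Z where Z: "zonoid Z" "intersection_body K = polar_body Z"
    using assms(1) unfolding polar_zonoid_def by blast
  then obtain \<mu> :: "(real ^ 4) measure" where \<mu>: "sets \<mu> = sets (restrict_space borel (sphere 0 1))"
      "finite_measure \<mu>"
    and h': "\<forall>u\<in>sphere 0 1. support_function Z u = (\<integral>v. \<bar>u \<bullet> v\<bar> \<partial>\<mu>)"
    unfolding zonoid_def by blast
  have h: "support_function Z u = (\<integral>v. \<bar>u \<bullet> v\<bar> \<partial>\<mu>)" if "norm u = 1" for u
    using h' that by simp
  have Dpos: "0 < D z" for z
    unfolding D_def by (rule integral_revolution_radial_cubed_pos) (auto simp: add_pos_nonneg)
  have id: "(\<lambda>v. v) \<in> \<mu> \<rightarrow>\<^sub>M borel"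
    by (simp add: measurable_cong_sets[OF \<mu>(1) refl] measurable_restrict_space1)
  have [measurable]: "(\<lambda>v. \<bar>u \<bullet> v\<bar>) \<in> borel_measurable \<mu>" for u :: "real ^ 4"
    by (rule measurable_compose[OF id]) measurable
  define G where "G z = 3 / (4 * pi * D z)" for z
  have G0: "0 < G z" for z using Dpos[of z] by (simp add: G_def)
  have cosine: "integrable \<mu> (\<lambda>v. \<bar>x \<bullet> v\<bar>) \<and> (\<integral>v. \<bar>x \<bullet> v\<bar> \<partial>\<mu>) = G z"
    if x: "(norm x)\<^sup>2 = 1 + z\<^sup>2" "x $ 4 = z" for x z
  proof -
    \<comment> \<open>This \<open>l\<close> both normalises \<open>x\<close> and is the distance of
      \<open>\<xi>\<close> from the axis; hence the factor \<open>l\<close> from homogeneity cancels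
      the one in the section formula.\<close>
    define l where "l = 1 / sqrt (1 + z\<^sup>2)"
    have s: "0 < 1 + z\<^sup>2" by (simp add: add_pos_nonneg)
    then have l: "0 < l" "l\<^sup>2 = 1 / (1 + z\<^sup>2)" by (auto simp: l_def power_divide)
    have nx: "norm x = 1 / l"
      using x(1) s by (simp add: l_def) (metis norm_ge_zero real_sqrt_unique)
    define \<xi> where "\<xi> = l *\<^sub>R x"
    have \<xi>: "norm \<xi> = 1" using l nx by (simp add: \<xi>_def)
    have "1 - (\<xi> $ 4)\<^sup>2 = l\<^sup>2"
      using s by (simp add: \<xi>_def x(2) power_mult_distrib l(2) field_simps)
    then have "radial_function (intersection_body K) \<xi> = 4 * pi / (3 * l) * D z"
      using hyperplane_volume_section[OF \<xi> _ l(1)]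
      by (simp add: radial_function_intersection_body[OF \<xi>] D_def l_def)
    moreover have "support_function Z \<xi> = 1 / radial_function (polar_body Z) \<xi>"
      using Z(1) bounded_intersection_body[OF compact] \<xi> unfolding zonoid_def Z(2)
      by (intro support_function_eq_inverse_radial_function) auto
    ultimately have "(\<integral>v. \<bar>\<xi> \<bullet> v\<bar> \<partial>\<mu>) = l * G z"
      unfolding h[OF \<xi>, symmetric] Z(2)[symmetric] by (simp add: G_def)
    moreover have "\<bar>\<xi> \<bullet> v\<bar> = l * \<bar>x \<bullet> v\<bar>" for v
      using l by (simp add: \<xi>_def abs_mult)
    ultimately have eq: "(\<integral>v. \<bar>x \<bullet> v\<bar> \<partial>\<mu>) = G z" using l(1) by simp
    \<comment> \<open>A function that is not integrable has integral \<open>0\<close> by convention,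
      whereas \<open>G z > 0\<close>.\<close>
    moreover have "integrable \<mu> (\<lambda>v. \<bar>x \<bullet> v\<bar>)"
      using eq G0[of z] not_integrable_integral_eq by fastforce
    ultimately show ?thesis by simp
  qed
  obtain g where g: "hyperplane_isometry (axis 4 1) g"
    using hyperplane_isometry_exists[of "axis 4 1"] by (auto simp: axis_eq_0_iff)
  then have lin: "linear g" and ng: "\<And>y. norm (g y) = norm y" and ran: "range g = {x. axis 4 1 \<bullet> x = 0}"
    unfolding hyperplane_isometry_def by auto
  have g4: "g y $ 4 = 0" for y
    using ran rangeI[of g y] by (simp add: inner_axis')
  \<comment> \<open>The measure on the sphere is pushed forward to the whole space, as the averaging
    lemma expects Borel sets of that space.\<close>
  define \<nu> where "\<nu> = distr \<mu> borel (\<lambda>v. v)"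
  have "G (2 * w) + 3 * G 0 \<le> 4 * G w"
  proof (rule zonoid_average_double[OF _ _ lin])
    show "finite_measure \<nu>"
      unfolding \<nu>_def by (rule finite_measure.finite_measure_distr[OF \<mu>(2) id])
    show "sets \<nu> = sets borel" by (simp add: \<nu>_def)
    show "0 \<le> G z" for z using G0[of z] by simp
    show "0 \<le> w" by fact
    fix y :: "real ^ 3" and z :: real assume y: "norm y = 1" and z: "0 \<le> z"
    \<comment> \<open>Both points have height \<open>z\<close> and distance \<open>1\<close> from
      the axis, and the mean of \<open>\<bar>a \<bullet> v\<bar>\<close> and
      \<open>\<bar>b \<bullet> v\<bar>\<close> is exactly the maximum in the averaging
      lemma.\<close>
    define a b where "a = z *\<^sub>R axis 4 1 + g y" and "b = z *\<^sub>R axis 4 1 - g y"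
    have "(norm a)\<^sup>2 = 1 + z\<^sup>2" "(norm b)\<^sup>2 = 1 + z\<^sup>2"
      unfolding power2_norm_eq_inner a_def b_def using g4[of y] ng[of y] y
      by (simp_all add: inner_add_left inner_add_right inner_diff_left inner_diff_right inner_axis
          inner_axis' inner_axis_axis norm_eq_1 power2_eq_square)
    moreover have "a $ 4 = z" "b $ 4 = z" using g4[of y] by (simp_all add: a_def b_def)
    ultimately have ab: "integrable \<mu> (\<lambda>v. \<bar>a \<bullet> v\<bar>)" "(\<integral>v. \<bar>a \<bullet> v\<bar> \<partial>\<mu>) = G z"
      "integrable \<mu> (\<lambda>v. \<bar>b \<bullet> v\<bar>)" "(\<integral>v. \<bar>b \<bullet> v\<bar> \<partial>\<mu>) = G z"
      using cosine by blast+
    have max: "max \<bar>g y \<bullet> v\<bar> (z * \<bar>axis 4 1 \<bullet> v\<bar>) = (\<bar>a \<bullet> v\<bar> + \<bar>b \<bullet> v\<bar>) / 2" for v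
    proof -
      have "max \<bar>s\<bar> \<bar>t\<bar> = (\<bar>t + s\<bar> + \<bar>t - s\<bar>) / 2" for s t :: real
        by (auto simp: max_def abs_if)
      from this[of "g y \<bullet> v" "z * (axis 4 1 \<bullet> v)"] show ?thesis
        using z by (simp add: a_def b_def inner_add_left inner_diff_left abs_mult)
    qed
    have "(\<integral>\<^sup>+v. ennreal (max \<bar>g y \<bullet> v\<bar> (z * \<bar>axis 4 1 \<bullet> v\<bar>)) \<partial>\<nu>) =
        (\<integral>\<^sup>+v. ennreal (max \<bar>g y \<bullet> v\<bar> (z * \<bar>axis 4 1 \<bullet> v\<bar>)) \<partial>\<mu>)"
      unfolding \<nu>_def by (rule nn_integral_distr[OF id]) measurable
    also have "\<dots> = ennreal (\<integral>v. (\<bar>a \<bullet> v\<bar> + \<bar>b \<bullet> v\<bar>) / 2 \<partial>\<mu>)"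
      unfolding max using ab by (intro nn_integral_eq_integral) auto
    also have "(\<integral>v. (\<bar>a \<bullet> v\<bar> + \<bar>b \<bullet> v\<bar>) / 2 \<partial>\<mu>) = G z"
      using ab by simp
    finally show "(\<integral>\<^sup>+v. ennreal (max \<bar>g y \<bullet> v\<bar> (z * \<bar>axis 4 1 \<bullet> v\<bar>)) \<partial>\<nu>) = ennreal (G z)" .
  qed
  then have "3 / (4 * pi) * (1 / D (2 * w) + 3 / D 0) \<le> 3 / (4 * pi) * (4 / D w)"
    by (simp add: G_def distrib_left)
  then show ?thesis by (rule mult_left_le_imp_le) simp
qed

end

section \<open>Contradiction between the averaged inequality and the expansion at the axis\<close>

theorem corollary2:
  fixes K :: "(real^4) set"
  assumes "convex_body K"
    and "origin_symmetric K"
    and "body_of_revolution K"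
    and "\<exists>\<delta>. 0 < \<delta> \<and> \<delta> \<le> 1 \<and> C2_on {1 - \<delta>..1} (revolution_radial K)"
    and "revolution_radial K 1 + vector_derivative (revolution_radial K) (at 1 within {0..1}) = 0"
  shows "\<not> polar_zonoid (intersection_body K)"
proof
  assume pz: "polar_zonoid (intersection_body K)"
  interpret symmetric_body_of_revolution K by unfold_locales fact+
  obtain d \<rho>' where d: "0 < d" "d \<le> 1"
    and deriv: "\<And>t. t \<in> {1 - d..1} \<Longrightarrow> (\<rho> has_real_derivative \<rho>' t) (at t within {1 - d..1})"
    using assms(4) unfolding C2_on_def by blast
  \<comment> \<open>The derivatives within \<open>{1 - d..1}\<close> and within
    \<open>{0..1}\<close> are both the left derivative at \<open>1\<close>.\<close>
  have left: "at 1 within {a..1} = at_left 1" if "a < 1" for a :: real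
    using that by (rule at_within_Icc_at_left)
  have d1: "(\<rho> has_real_derivative \<rho>' 1) (at_left 1)"
    using deriv[of 1] d left[of "1 - d"] by simp
  then have "vector_derivative \<rho> (at 1 within {0..1}) = \<rho>' 1"
    unfolding left[OF zero_less_one] has_real_derivative_iff_has_vector_derivative
    by (intro vector_derivative_within) auto
  with assms(5) have "\<rho>' 1 = - \<rho> 1" by simp
  \<comment> \<open>The chain rule gives \<open>3 * \<rho> 1 ^ 2 * (- \<rho> 1)\<close>, the slope
    at which the fourth order term vanishes.\<close>
  with d1 have "((\<lambda>t. \<rho> t ^ 3) has_real_derivative - 3 * \<rho> 1 ^ 3) (at_left 1)"
    by (auto intro!: derivative_eq_intros simp: power2_eq_square power3_eq_cube)
  moreover have "continuous_on {1 - d..1} \<rho>"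
    using deriv by (rule DERIV_continuous_on)
  then have "continuous_on {1 - d..1} (\<lambda>t. \<rho> t ^ 3)"
    by (intro continuous_intros)
  moreover have "(\<lambda>t. \<rho> t ^ 3) integrable_on {0..1}"
    by (rule set_borel_integral_eq_integral(1)[OF set_integrable_revolution_radial_cubed]) auto
  ultimately obtain z where "0 < z" and
    z: "4 / integral {0..1 / sqrt (1 + z\<^sup>2)} (\<lambda>t. \<rho> t ^ 3) <
      1 / integral {0..1 / sqrt (1 + (2 * z)\<^sup>2)} (\<lambda>t. \<rho> t ^ 3) +
      3 / integral {0..1 / sqrt (1 + 0\<^sup>2)} (\<lambda>t. \<rho> t ^ 3)"
    using reciprocal_integral_not_double[OF d, of "\<lambda>t. \<rho> t ^ 3"]
      revolution_radial_pos[of 1] integral_revolution_radial_cubed_pos[of 1] by auto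
  then show False
    using reciprocal_integral_double_if_polar_zonoid[OF pz, of z] by simp
qed

end
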